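(* In the Hopf algebra $\mathrm{QSym}_{\mathbb C(q,t)}$ of quasisymmetric functions over $\mathbb C(q,t)$ the following hold. (a) For all compositions $\alpha,\beta$, $$\mathcal D_\alpha(q,t)\,\mathcal D_\beta(q,t)=\sum_{\gamma\in\alpha\,\overline{\overline{\sqcup\!\sqcup}}\,\beta}(q+t)^{\mathrm c_1(\gamma)}\,t^{\mathrm c_2(\gamma)}\,\mathcal D_{\gamma^+}(q,t).$$ (b) For every composition $\gamma$, $$\triangle\mathcal D_\gamma(q,t)=\sum_{\alpha\cdot\beta=\gamma}\mathcal D_\alpha(q,t)\otimes\mathcal D_\beta(q,t),$$ where $\alpha\cdot\beta$ is concatenation and the sum is over all pairs of (possibly empty) compositions with $\alpha\cdot\beta=\gamma$.
   Context: A composition is a finite (possibly empty) tuple $\alpha=(\alpha_1,\dots,\alpha_l)$ of positive integers; $\ell(\alpha)=l$, $|\alpha|=\sum\alpha_i$. Write $\alpha\preceq\beta$ (equivalently $\beta\succeq\alpha$) if $\alpha$ refines $\beta$, i.e. $\beta$ is obtained from $\alpha$ by adding together some adjacent parts. $M_\alpha=\sum_{i_1<\dots<i_l}x_{i_1}^{\alpha_1}\cdots x_{i_l}^{\alpha_l}$ is the monomial quasisymmetric function; the coproduct of $\mathrm{QSym}$ is $\triangle M_\alpha=\sum_{\beta\cdot\gamma=\alpha}M_\beta\otimes M_\gamma$. For a composition $\alpha$ with $|\alpha|=n$ define $$\mathcal D_\alpha(q,t)=\sum_{\beta\succeq\alpha}q^{\ell(\beta)-n}(-t)^{\ell(\alpha)-\ell(\beta)}M_\beta\in\mathrm{QSym}_{\mathbb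 C(q,t)}.$$ Two-way overlapping shuffles. Let $\alpha=(\alpha_1,\dots,\alpha_l)$, $\beta=(\beta_1,\dots,\beta_k)$. A shuffle of $\alpha$ and $\beta$ is a sequence of length $l+k$ obtained by choosing a $k$-element subset $D\subseteq\{1,\dots,l+k\}$, placing $\beta_1,\dots,\beta_k$ in this order in the positions in $D$ and $\alpha_1,\dots,\alpha_l$ in this order in the other positions. A two-way overlapping shuffle of $\alpha$ and $\beta$ is an expression obtained from such a shuffle by replacing some (possibly none) of the commas inside consecutive pairs of the form $(\alpha_i,\beta_j)$ by the symbol $+_1$ and some (possibly none) of the commas inside consecutive pairs of the form $(\beta_j,\alpha_i)$ by the symbol $+_2$. $\alpha\,\overline{\overline{\sqcup\!\sqcup}}\,\beta$ is the multiset of all two-way overlapping shuffles, one for each choice of $D$ and of the commas to be replaced. For such $\gamma$, $\gamma^+$ is the composition obtained by replacing every $+_1$ and $+_2$ by ordinary addition, and $\mathrm c_1(\gamma)$ (resp. $\mathrm c_2(\gamma)$) is the number of occurrences of $+_1$ (resp. $+_2$) in $\gamma$. *)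

theory Defs
  imports
    Complex_Main
    "HOL-Library.Multiset"
    "HOL-Library.Poly_Mapping"
    "HOL-Computational_Algebra.Fraction_Field"
    "HOL-Computational_Algebra.Polynomial"
begin

section \<open>Compositions\<close>

definition composition :: "nat list \<Rightarrow> bool" where
  "composition \<alpha> \<longleftrightarrow> (\<forall>a\<in>set \<alpha>. 0 < a)"

text \<open>\<open>refines \<alpha> \<beta>\<close> is \<open>\<alpha> \<preceq> \<beta>\<close>: cut \<open>\<alpha>\<close> into nonempty blocks of adjacent parts and add up each block.\<close>

definition refines :: "nat list \<Rightarrow> nat list \<Rightarrow> bool" where
  "refines \<alpha> \<beta> \<longleftrightarrow>
     (\<exists>blocks. [] \<notin> set blocks \<and> concat blocks = \<alpha> \<and> map sum_list blocks = \<beta>)"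

section \<open>Monomials in infinitely many variables\<close>

type_synonym monomial = "nat \<Rightarrow>\<^sub>0 nat"

text \<open>\<open>xpow is \<alpha>\<close> is the monomial \<open>x\<^bsub>is!0\<^esub>^(\<alpha>!0) x\<^bsub>is!1\<^esub>^(\<alpha>!1) \<dots>\<close>.  Variables are indexed by \<open>0, 1, 2, \<dots>\<close>.\<close>

definition xpow :: "nat list \<Rightarrow> nat list \<Rightarrow> monomial" where
  "xpow is \<alpha> = sum_list (map2 Poly_Mapping.single is \<alpha>)"

definition mdeg :: "monomial \<Rightarrow> nat" where
  "mdeg m = (\<Sum>i\<in>Poly_Mapping.keys m. Poly_Mapping.lookup m i)"

lemma xpow_Nil [simp]: "xpow [] as = 0" "xpow is [] = 0"
  by (simp_all add: xpow_def)

lemma xpow_Cons [simp]: "xpow (i # is) (a # as) = Poly_Mapping.single i a + xpow is as"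
  by (simp add: xpow_def)

lemma mdeg_superset:
  assumes "finite A" "Poly_Mapping.keys m \<subseteq> A"
  shows "mdeg m = (\<Sum>i\<in>A. Poly_Mapping.lookup m i)"
  unfolding mdeg_def using assms
  by (intro sum.mono_neutral_left) (auto simp: in_keys_iff)

lemma mdeg_add: "mdeg (a + b) = mdeg a + mdeg b"
proof -
  let ?A = "Poly_Mapping.keys a \<union> Poly_Mapping.keys b"
  have "mdeg (a + b) = (\<Sum>i\<in>?A. Poly_Mapping.lookup (a + b) i)"
    by (intro mdeg_superset keys_add) auto
  also have "\<dots> = mdeg a + mdeg b"
    by (simp add: lookup_add sum.distrib mdeg_superset[of ?A])
  finally show ?thesis .
qed

lemma mdeg_single [simp]: "mdeg (Poly_Mapping.single i a) = a"
  using mdeg_superset[of "{i}" "Poly_Mapping.single i a"] by simp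

lemma mdeg_zero [simp]: "mdeg 0 = 0"
  by (simp add: mdeg_def)

lemma mdeg_xpow: "length is = length as \<Longrightarrow> mdeg (xpow is as) = sum_list as"
  by (induction "is" as rule: list_induct2) (auto simp: mdeg_add)

lemma lookup_xpow_notin:
  "i \<notin> set is \<Longrightarrow> Poly_Mapping.lookup (xpow is as) i = 0"
proof (induction "is" arbitrary: as)
  case (Cons j js)
  then show ?case by (cases as) (auto simp: lookup_add lookup_single)
qed auto

lemma map_lookup_xpow:
  assumes "length is = length as" "distinct is"
  shows "map (Poly_Mapping.lookup (xpow is as)) is = as"
  using assms
proof (induction "is" as rule: list_induct2)
  case (Cons i "is" a as)
  have "map (Poly_Mapping.lookup (xpow (i # is) (a # as))) is = map (Poly_Mapping.lookup (xpow is as)) is"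
    using Cons.prems by (auto simp: lookup_add lookup_single when_def)
  also have "\<dots> = as"
    using Cons.IH Cons.prems by simp
  finally have "map (Poly_Mapping.lookup (xpow (i # is) (a # as))) is = as" .
  moreover have "Poly_Mapping.lookup (xpow (i # is) (a # as)) i = a"
    using Cons.prems by (simp add: lookup_add lookup_xpow_notin)
  ultimately show ?case by (simp only: list.map)
qed auto

lemma xpow_map_lookup:
  assumes "distinct is" "Poly_Mapping.keys m \<subseteq> set is"
  shows "xpow is (map (Poly_Mapping.lookup m) is) = m"
proof (rule poly_mapping_eqI)
  fix k
  let ?as = "map (Poly_Mapping.lookup m) is"
  have eq: "map (Poly_Mapping.lookup (xpow is ?as)) is = ?as"
    using assms by (intro map_lookup_xpow) auto
  show "Poly_Mapping.lookup (xpow is ?as) k = Poly_Mapping.lookup m k"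
  proof (cases "k \<in> set is")
    case True
    then show ?thesis using eq by auto
  next
    case False
    then show ?thesis using assms(2) by (auto simp: lookup_xpow_notin in_keys_iff)
  qed
qed

lemma xpow_add:
  assumes "length us = length is" "length vs = length is"
  shows "xpow is us + xpow is vs = xpow is (map2 (+) us vs)"
proof -
  have "length is = length us" "length us = length vs" using assms by auto
  then show ?thesis
  proof (induction "is" us vs rule: list_induct3)
    case (Cons i "is" u us v vs)
    have "xpow (i # is) (u # us) + xpow (i # is) (v # vs)
        = Poly_Mapping.single i u + Poly_Mapping.single i v + (xpow is us + xpow is vs)"
      by (simp add: ac_simps)
    then show ?case by (simp add: Cons.IH single_add)
  qed simp
qed

lemma keys_xpow_subset: "Poly_Mapping.keys (xpow is as) \<subseteq> set is"
  using lookup_xpow_notin by (fastforce simp: in_keys_iff)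

lemma keys_xpow:
  assumes "composition \<alpha>" "length is = length \<alpha>" "distinct is"
  shows "Poly_Mapping.keys (xpow is \<alpha>) = set is"
proof
  show "set is \<subseteq> Poly_Mapping.keys (xpow is \<alpha>)"
  proof
    fix i assume "i \<in> set is"
    then have "Poly_Mapping.lookup (xpow is \<alpha>) i \<in> set (map (Poly_Mapping.lookup (xpow is \<alpha>)) is)"
      by auto
    then have "Poly_Mapping.lookup (xpow is \<alpha>) i \<in> set \<alpha>"
      using map_lookup_xpow[OF assms(2,3)] by simp
    then show "i \<in> Poly_Mapping.keys (xpow is \<alpha>)"
      using assms(1) by (auto simp: composition_def in_keys_iff)
  qed
qed (rule keys_xpow_subset)

lemma xpow_inject:
  assumes "composition \<alpha>" "composition \<beta>" "length is = length \<alpha>" "length js = length \<beta>"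
    and "sorted_wrt (<) is" "sorted_wrt (<) js"
  shows "xpow is \<alpha> = xpow js \<beta> \<longleftrightarrow> is = js \<and> \<alpha> = \<beta>"
proof
  assume eq: "xpow is \<alpha> = xpow js \<beta>"
  have d: "distinct is" "distinct js" "sorted is" "sorted js"
    using assms strict_sorted_iff by auto
  have "set is = set js" using keys_xpow assms d eq by metis
  then have "is = js" using d by (metis sorted_distinct_set_unique)
  moreover have "\<alpha> = \<beta>" using map_lookup_xpow assms d eq \<open>is = js\<close> by metis
  ultimately show "is = js \<and> \<alpha> = \<beta>" ..
qed auto

section \<open>Quasisymmetric power series\<close>

text \<open>A formal power series in \<open>x\<^sub>0, x\<^sub>1, \<dots>\<close> is given by its coefficient function on monomials.\<close>

type_synonym 'k pseries = "monomial \<Rightarrow> 'k"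

definition ps_mult :: "'k::comm_ring_1 pseries \<Rightarrow> 'k pseries \<Rightarrow> 'k pseries" where
  "ps_mult f g m = (\<Sum>(a, b)\<in>{(a, b). a + b = m}. f a * g b)"

definition quasisymmetric :: "'k::comm_ring_1 pseries \<Rightarrow> bool" where
  "quasisymmetric f \<longleftrightarrow>
     (\<exists>d. \<forall>m. f m \<noteq> 0 \<longrightarrow> mdeg m \<le> d) \<and>
     (\<forall>\<alpha> is js. composition \<alpha> \<and> length is = length \<alpha> \<and> length js = length \<alpha> \<and>
        sorted_wrt (<) is \<and> sorted_wrt (<) js \<longrightarrow> f (xpow is \<alpha>) = f (xpow js \<alpha>))"

text \<open>The coefficient of \<open>m\<close> in \<open>\<Sum>\<^bsub>i\<^sub>1<\<dots><i\<^sub>l\<^esub> x\<^bsub>i\<^sub>1\<^esub>^\<alpha>\<^sub>1 \<cdots> x\<^bsub>i\<^sub>l\<^esub>^\<alpha>\<^sub>l\<close>.\<close>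

definition monomial_series :: "nat list \<Rightarrow> 'k::comm_ring_1 pseries" where
  "monomial_series \<alpha> m =
     of_nat (card {is. length is = length \<alpha> \<and> sorted_wrt (<) is \<and> xpow is \<alpha> = m})"

lemma decomp_bij:
  assumes "distinct is" "length is = length as"
  shows "bij_betw (\<lambda>(us, vs). (xpow is us, xpow is vs))
     {(us, vs). length us = length is \<and> length vs = length is \<and> map2 (+) us vs = as}
     {(a, b). a + b = xpow is as}"
proof (rule bij_betw_byWitness[where f' = "\<lambda>(a, b). (map (Poly_Mapping.lookup a) is, map (Poly_Mapping.lookup b) is)"], goal_cases)
  case 1
  then show ?case using assms by (auto simp: map_lookup_xpow)
next
  case 2
  have "Poly_Mapping.keys a \<subseteq> set is \<and> Poly_Mapping.keys b \<subseteq> set is" if "a + b = xpow is as" for a b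
  proof -
    have "Poly_Mapping.keys a \<subseteq> Poly_Mapping.keys (a + b)" "Poly_Mapping.keys b \<subseteq> Poly_Mapping.keys (a + b)"
      by (auto simp: in_keys_iff lookup_add)
    then show ?thesis using that keys_xpow_subset[of "is" as] by auto
  qed
  then show ?case using assms by (auto simp: xpow_map_lookup)
next
  case 3
  then show ?case by (auto simp: xpow_add)
next
  case 4
  have "map2 (+) (map (Poly_Mapping.lookup a) is) (map (Poly_Mapping.lookup b) is) = as"
    if "a + b = xpow is as" for a b
  proof -
    have "map2 (+) (map (Poly_Mapping.lookup a) is) (map (Poly_Mapping.lookup b) is)
        = map (Poly_Mapping.lookup (a + b)) is"
      by (induction "is") (auto simp: lookup_add)
    then show ?thesis using that assms by (simp add: map_lookup_xpow)
  qed
  then show ?case by auto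
qed

lemma monomial_as_xpow:
  obtains "is" as where "distinct is" "length is = length as" "m = xpow is as"
proof
  let ?is = "sorted_list_of_set (Poly_Mapping.keys m)"
  show "distinct ?is" "length ?is = length (map (Poly_Mapping.lookup m) ?is)"
    "m = xpow ?is (map (Poly_Mapping.lookup m) ?is)"
    using xpow_map_lookup[of ?is m] by auto
qed

lemma finite_decomp: "finite {(a, b). a + b = (m::monomial)}"
proof -
  obtain "is" as where *: "distinct is" "length is = length as" "m = xpow is as"
    by (rule monomial_as_xpow)
  let ?L = "{xs. set xs \<subseteq> {..sum_list as} \<and> length xs = length as}"
  let ?P = "{(us, vs). length us = length is \<and> length vs = length is \<and> map2 (+) us vs = as}"
  have "?P \<subseteq> ?L \<times> ?L"
  proof (rule subsetI)
    fix p assume "p \<in> ?P"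
    then obtain us vs where p: "p = (us, vs)" "length us = length is" "length vs = length is"
      "map2 (+) us vs = as" by blast
    have "length us = length vs" using p by simp
    then have "sum_list (map2 (+) us vs) = sum_list us + sum_list vs"
      by (induction us vs rule: list_induct2) simp_all
    then have "sum_list us \<le> sum_list as" "sum_list vs \<le> sum_list as"
      using p(4) by simp_all
    then have "set us \<subseteq> {..sum_list as}" "set vs \<subseteq> {..sum_list as}"
      using member_le_sum_list by (fastforce intro: order_trans)+
    then show "p \<in> ?L \<times> ?L" using p *(2) by simp
  qed
  moreover have "finite (?L \<times> ?L)"
    by (intro finite_cartesian_product finite_lists_length_eq finite_atMost)
  ultimately have "finite ?P" by (rule finite_subset)
  then show ?thesis
    unfolding *(3) bij_betw_finite[OF decomp_bij[OF *(1,2)], symmetric] .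
qed

lemma quasisymmetric_weak:
  assumes "quasisymmetric f" "length is = length as" "length js = length as"
    "sorted_wrt (<) is" "sorted_wrt (<) js"
  shows "f (xpow is as) = f (xpow js as)"
proof -
  define sel where "sel is = map fst (filter (\<lambda>p. snd p \<noteq> 0) (zip is as))" for "is" :: "nat list"
  define \<alpha> where "\<alpha> = filter (\<lambda>a. a \<noteq> 0) as"
  have *: "length (sel is) = length \<alpha> \<and> xpow (sel is) \<alpha> = xpow is as \<and> sorted_wrt (<) (sel is)"
    if "length is = length as" "sorted_wrt (<) is" for "is"
  proof -
    have "length (sel is) = length \<alpha> \<and> xpow (sel is) \<alpha> = xpow is as \<and> set (sel is) \<subseteq> set is
        \<and> sorted_wrt (<) (sel is)"
      using that unfolding sel_def \<alpha>_def
      by (induction "is" as rule: list_induct2) (auto simp: subset_iff)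
    then show ?thesis by simp
  qed
  have "composition \<alpha>" by (auto simp: composition_def \<alpha>_def)
  then have "f (xpow (sel is) \<alpha>) = f (xpow (sel js) \<alpha>)"
    using assms * unfolding quasisymmetric_def by blast
  then show ?thesis using * assms by simp
qed

lemma ps_mult_xpow:
  assumes "distinct is" "length is = length as"
  shows "ps_mult f g (xpow is as) =
    (\<Sum>(us, vs)\<in>{(us, vs). length us = length as \<and> length vs = length as \<and> map2 (+) us vs = as}.
       f (xpow is us) * g (xpow is vs))"
proof -
  let ?A = "{(us, vs). length us = length as \<and> length vs = length as \<and> map2 (+) us vs = as}"
  have "bij_betw (\<lambda>(us, vs). (xpow is us, xpow is vs)) ?A {(a, b). a + b = xpow is as}"
    using decomp_bij[OF assms] unfolding assms(2) .
  from sum.reindex_bij_betw[OF this, of "\<lambda>(a, b). f a * g b"]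
  have "ps_mult f g (xpow is as)
      = (\<Sum>p\<in>?A. (\<lambda>(a, b). f a * g b) ((\<lambda>(us, vs). (xpow is us, xpow is vs)) p))"
    unfolding ps_mult_def by (rule sym)
  also have "\<dots> = (\<Sum>(us, vs)\<in>?A. f (xpow is us) * g (xpow is vs))"
    by (rule sum.cong) (auto split: prod.splits)
  finally show ?thesis .
qed

lemma quasisymmetric_mult:
  assumes f: "quasisymmetric f" and g: "quasisymmetric g"
  shows "quasisymmetric (ps_mult f g)"
  unfolding quasisymmetric_def
proof (intro conjI allI impI; (elim conjE)?)
  obtain d e where d: "\<And>m. f m \<noteq> 0 \<Longrightarrow> mdeg m \<le> d" and e: "\<And>m. g m \<noteq> 0 \<Longrightarrow> mdeg m \<le> e"
    using f g unfolding quasisymmetric_def by blast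
  have "mdeg m \<le> d + e" if nz: "ps_mult f g m \<noteq> 0" for m
  proof -
    obtain p where p: "p \<in> {(a, b). a + b = m}" "(case p of (a, b) \<Rightarrow> f a * g b) \<noteq> 0"
      using nz unfolding ps_mult_def by (rule sum.not_neutral_contains_not_neutral)
    obtain a b where "p = (a, b)" by (cases p)
    with p have ab: "a + b = m" "f a * g b \<noteq> 0" by simp_all
    have "f a \<noteq> 0" using ab(2) by (rule contrapos_nn) simp
    moreover have "g b \<noteq> 0" using ab(2) by (rule contrapos_nn) simp
    ultimately have "mdeg a \<le> d" "mdeg b \<le> e" using d e by blast+
    then show ?thesis by (simp add: ab(1)[symmetric] mdeg_add)
  qed
  then show "\<exists>d. \<forall>m. ps_mult f g m \<noteq> 0 \<longrightarrow> mdeg m \<le> d" by blast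
next
  fix \<alpha> "is" js :: "nat list"
  assume *: "length is = length \<alpha>" "length js = length \<alpha>" "sorted_wrt (<) is" "sorted_wrt (<) js"
  then have d: "distinct is" "distinct js" by (simp_all add: strict_sorted_iff)
  have fg: "f (xpow is us) = f (xpow js us)" "g (xpow is us) = g (xpow js us)"
    if "length us = length \<alpha>" for us
    using quasisymmetric_weak[OF f, of "is" us js] quasisymmetric_weak[OF g, of "is" us js] that *
    by simp_all
  show "ps_mult f g (xpow is \<alpha>) = ps_mult f g (xpow js \<alpha>)"
    unfolding ps_mult_xpow[OF d(1) *(1)] ps_mult_xpow[OF d(2) *(2)]
  proof (rule sum.cong[OF refl], goal_cases)
    case (1 p)
    obtain us vs where "p = (us, vs)" by (cases p)
    with 1 show ?case using fg(1)[of us] fg(2)[of vs] by simp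
  qed
qed

lemma quasisymmetric_zero: "quasisymmetric (\<lambda>m. 0)"
  by (simp add: quasisymmetric_def)

lemma quasisymmetric_add:
  assumes f: "quasisymmetric f" and g: "quasisymmetric g"
  shows "quasisymmetric (\<lambda>m. f m + g m)"
proof -
  obtain d e where d: "\<And>m. f m \<noteq> 0 \<Longrightarrow> mdeg m \<le> d" and e: "\<And>m. g m \<noteq> 0 \<Longrightarrow> mdeg m \<le> e"
    using f g unfolding quasisymmetric_def by blast
  have "mdeg m \<le> max d e" if "f m + g m \<noteq> 0" for m
    using that d[of m] e[of m] by (cases "f m = 0") auto
  moreover have "f (xpow is \<alpha>) + g (xpow is \<alpha>) = f (xpow js \<alpha>) + g (xpow js \<alpha>)"
    if "length is = length \<alpha>" "length js = length \<alpha>" "sorted_wrt (<) is" "sorted_wrt (<) js"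
    for "is" js \<alpha>
    using quasisymmetric_weak[OF f that] quasisymmetric_weak[OF g that] by (rule arg_cong2)
  ultimately show ?thesis unfolding quasisymmetric_def by blast
qed

lemma quasisymmetric_scale:
  assumes f: "quasisymmetric f"
  shows "quasisymmetric (\<lambda>m. c * f m)"
proof -
  obtain d where d: "\<And>m. f m \<noteq> 0 \<Longrightarrow> mdeg m \<le> d"
    using f unfolding quasisymmetric_def by blast
  have "mdeg m \<le> d" if "c * f m \<noteq> 0" for m
    using that d[of m] by (cases "f m = 0") auto
  moreover have "c * f (xpow is \<alpha>) = c * f (xpow js \<alpha>)"
    if "length is = length \<alpha>" "length js = length \<alpha>" "sorted_wrt (<) is" "sorted_wrt (<) js"
    for "is" js \<alpha>
    using quasisymmetric_weak[OF f that] by (rule arg_cong)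
  ultimately show ?thesis unfolding quasisymmetric_def by blast
qed

lemma quasisymmetric_uminus: "quasisymmetric f \<Longrightarrow> quasisymmetric (\<lambda>m. - f m)"
  using quasisymmetric_scale[of f "- 1"] by simp

lemma monomial_series_xpow:
  assumes "composition \<alpha>" "composition \<beta>" "length is = length \<beta>" "sorted_wrt (<) is"
  shows "monomial_series \<alpha> (xpow is \<beta>) = (if \<alpha> = \<beta> then 1 else 0)"
proof -
  have "{ks. length ks = length \<alpha> \<and> sorted_wrt (<) ks \<and> xpow ks \<alpha> = xpow is \<beta>}
      = (if \<alpha> = \<beta> then {is} else {})"
    using assms by (auto simp: xpow_inject)
  then show ?thesis by (simp add: monomial_series_def)
qed

lemma quasisymmetric_monomial_series:
  assumes "composition \<alpha>"
  shows "quasisymmetric (monomial_series \<alpha>)"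
proof -
  have "mdeg m \<le> sum_list \<alpha>" if "(monomial_series \<alpha> m :: 'a) \<noteq> 0" for m
  proof -
    have "{is. length is = length \<alpha> \<and> sorted_wrt (<) is \<and> xpow is \<alpha> = m} \<noteq> {}"
      using that unfolding monomial_series_def by (metis card.empty of_nat_0)
    then show ?thesis using mdeg_xpow by fastforce
  qed
  then show ?thesis
    using assms unfolding quasisymmetric_def by (auto simp: monomial_series_xpow)
qed

lemma ps_mult_commute: "ps_mult f g = ps_mult g f"
proof
  fix m :: monomial
  have "bij_betw prod.swap {(a, b). a + b = m} {(a, b). a + b = m}"
    by (rule bij_betw_byWitness[where f' = prod.swap]) (auto intro: add.commute)
  from sum.reindex_bij_betw[OF this, of "\<lambda>(a, b). f a * g b"]
  show "ps_mult f g m = ps_mult g f m"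
    by (simp add: ps_mult_def case_prod_unfold mult.commute)
qed

lemma ps_mult_assoc: "ps_mult (ps_mult f g) h = ps_mult f (ps_mult g h)"
proof
  fix m :: monomial
  let ?D = "\<lambda>m::monomial. {(a, b). a + b = m}"
  have fin: "finite (?D n)" for n by (rule finite_decomp)
  have "ps_mult (ps_mult f g) h m = (\<Sum>p\<in>?D m. \<Sum>r\<in>?D (fst p). f (fst r) * g (snd r) * h (snd p))"
    by (simp add: ps_mult_def case_prod_unfold sum_distrib_right)
  also have "\<dots> = (\<Sum>(p, r)\<in>(SIGMA p:?D m. ?D (fst p)). f (fst r) * g (snd r) * h (snd p))"
    by (intro sum.Sigma) (auto simp: fin)
  also have "\<dots> = (\<Sum>(p, r)\<in>(SIGMA p:?D m. ?D (snd p)). f (fst p) * (g (fst r) * h (snd r)))"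
    by (rule sum.reindex_bij_witness
        [where i = "\<lambda>((a, s), (b, c)). ((a + b, c), (a, b))" and j = "\<lambda>((s, c), (a, b)). ((a, b + c), (b, c))"])
      (auto simp: algebra_simps)
  also have "\<dots> = (\<Sum>p\<in>?D m. \<Sum>r\<in>?D (snd p). f (fst p) * (g (fst r) * h (snd r)))"
    by (intro sum.Sigma[symmetric]) (auto simp: fin)
  also have "\<dots> = ps_mult f (ps_mult g h) m"
    by (simp add: ps_mult_def case_prod_unfold sum_distrib_left)
  finally show "ps_mult (ps_mult f g) h m = ps_mult f (ps_mult g h) m" .
qed

lemma monomial_series_Nil: "monomial_series [] m = (if m = 0 then 1 else 0)"
proof -
  have "{is::nat list. is = [] \<and> sorted_wrt (<) is \<and> xpow is [] = m} = (if m = 0 then {[]} else {})"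
    by auto
  then show ?thesis by (simp add: monomial_series_def)
qed

lemma ps_mult_one: "ps_mult (monomial_series []) f = f"
proof
  fix m :: monomial
  have "ps_mult (monomial_series []) f m = (\<Sum>p\<in>{(a, b). a + b = m}. if p = (0, m) then f m else 0)"
    unfolding ps_mult_def by (intro sum.cong) (auto simp: monomial_series_Nil split: if_splits)
  also have "\<dots> = f m" by (simp add: finite_decomp)
  finally show "ps_mult (monomial_series []) f m = f m" .
qed

section \<open>The algebra QSym\<close>

typedef (overloaded) 'k qsym = "{f :: 'k::comm_ring_1 pseries. quasisymmetric f}"
  morphisms coeff_qsym Abs_qsym
  using quasisymmetric_zero by blast

setup_lifting type_definition_qsym

instantiation qsym :: (comm_ring_1) comm_ring_1
begin

lift_definition zero_qsym :: "'a qsym" is "\<lambda>m. 0" by (rule quasisymmetric_zero)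
lift_definition one_qsym :: "'a qsym" is "\<lambda>m. if m = 0 then 1 else 0"
  using quasisymmetric_monomial_series[of "[]"]
  by (simp add: composition_def monomial_series_Nil[abs_def])
lift_definition plus_qsym :: "'a qsym \<Rightarrow> 'a qsym \<Rightarrow> 'a qsym" is "\<lambda>f g m. f m + g m"
  by (rule quasisymmetric_add)
lift_definition uminus_qsym :: "'a qsym \<Rightarrow> 'a qsym" is "\<lambda>f m. - f m"
  by (rule quasisymmetric_uminus)
lift_definition minus_qsym :: "'a qsym \<Rightarrow> 'a qsym \<Rightarrow> 'a qsym" is "\<lambda>f g m. f m - g m"
  using quasisymmetric_add[OF _ quasisymmetric_uminus] by simp
lift_definition times_qsym :: "'a qsym \<Rightarrow> 'a qsym \<Rightarrow> 'a qsym" is ps_mult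
  by (rule quasisymmetric_mult)

instance
proof
  fix a b c :: "'a qsym"
  show "a + b + c = a + (b + c)" by transfer (simp add: add.assoc)
  show "a + b = b + a" by transfer (simp add: add.commute)
  show "0 + a = a" by transfer simp
  show "- a + a = 0" by transfer simp
  show "a - b = a + - b" by transfer simp
  show "a * b * c = a * (b * c)" by transfer (rule ps_mult_assoc)
  show "a * b = b * a" by transfer (rule ps_mult_commute)
  show "1 * a = a"
    by transfer (simp add: ps_mult_one monomial_series_Nil[abs_def, symmetric])
  show "(a + b) * c = a * c + b * c"
    by transfer (simp add: ps_mult_def fun_eq_iff case_prod_unfold algebra_simps sum.distrib)
  show "(0::'a qsym) \<noteq> 1" by transfer (auto simp: fun_eq_iff)
qed

end

lift_definition qsym_scale :: "'k::comm_ring_1 \<Rightarrow> 'k qsym \<Rightarrow> 'k qsym" is "\<lambda>c f m. c * f m"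
  by (rule quasisymmetric_scale)

text \<open>The monomial quasisymmetric function \<open>M\<^sub>\<alpha>\<close>; unspecified if \<open>\<alpha>\<close> is not a composition.\<close>

definition QM :: "nat list \<Rightarrow> 'k::comm_ring_1 qsym" where
  "QM \<alpha> = Abs_qsym (monomial_series \<alpha>)"

lemma coeff_QM: "composition \<alpha> \<Longrightarrow> coeff_qsym (QM \<alpha>) = monomial_series \<alpha>"
  by (simp add: QM_def Abs_qsym_inverse quasisymmetric_monomial_series)

lemma vector_space_qsym_scale: "vector_space (qsym_scale :: 'k::field \<Rightarrow> 'k qsym \<Rightarrow> 'k qsym)"
proof
  fix a b :: 'k and x y :: "'k qsym"
  show "qsym_scale a (x + y) = qsym_scale a x + qsym_scale a y"
    by transfer (simp add: distrib_left)
  show "qsym_scale (a + b) x = qsym_scale a x + qsym_scale b x"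
    by transfer (simp add: distrib_right)
  show "qsym_scale a (qsym_scale b x) = qsym_scale (a * b) x"
    by transfer (simp add: mult.assoc)
  show "qsym_scale 1 x = x" by transfer simp
qed

lemma qsym_scale_mult_left: "qsym_scale c f * g = qsym_scale c (f * g)"
proof -
  have "ps_mult (\<lambda>m. c * coeff_qsym f m) (coeff_qsym g) m = c * ps_mult (coeff_qsym f) (coeff_qsym g) m" for m
    unfolding ps_mult_def sum_distrib_left by (rule sum.cong) (auto simp: mult.assoc)
  then show ?thesis
    by (simp add: coeff_qsym_inject[symmetric] times_qsym.rep_eq qsym_scale.rep_eq fun_eq_iff)
qed

lemma qsym_scale_mult_right: "f * qsym_scale c g = qsym_scale c (f * g)"
  using qsym_scale_mult_left[of c g f] by (simp only: mult.commute[of f])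

section \<open>The tensor product of QSym with itself\<close>

text \<open>The quotient of the vector space freely spanned by the pairs \<open>(f, g)\<close>
  by the span of the bilinearity relations.\<close>

type_synonym 'k pair_comb = "('k qsym \<times> 'k qsym) \<Rightarrow>\<^sub>0 'k"

abbreviation pair_scale :: "'k::field \<Rightarrow> 'k pair_comb \<Rightarrow> 'k pair_comb" where
  "pair_scale c \<equiv> Poly_Mapping.map ((*) c)"

lemma lookup_pair_scale: "Poly_Mapping.lookup (pair_scale c p) x = c * Poly_Mapping.lookup p x"
  by transfer (simp add: when_def)

interpretation pair_comb: vector_space "pair_scale :: 'k::field \<Rightarrow> 'k pair_comb \<Rightarrow> 'k pair_comb"
proof
  fix a b :: 'k and x y :: "'k pair_comb"
  show "pair_scale a (x + y) = pair_scale a x + pair_scale a y"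
    by (rule poly_mapping_eqI) (simp add: lookup_pair_scale lookup_add distrib_left)
  show "pair_scale (a + b) x = pair_scale a x + pair_scale b x"
    by (rule poly_mapping_eqI) (simp add: lookup_pair_scale lookup_add distrib_right)
  show "pair_scale a (pair_scale b x) = pair_scale (a * b) x"
    by (rule poly_mapping_eqI) (simp add: lookup_pair_scale mult.assoc)
  show "pair_scale 1 x = x"
    by (rule poly_mapping_eqI) (simp add: lookup_pair_scale)
qed

abbreviation pair_gen :: "'k::field qsym \<Rightarrow> 'k qsym \<Rightarrow> 'k pair_comb" where
  "pair_gen f g \<equiv> Poly_Mapping.single (f, g) 1"

definition bilinear_relations :: "'k::field pair_comb set" where
  "bilinear_relations =
     {pair_gen (f + f') g - pair_gen f g - pair_gen f' g | f f' g. True} \<union>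
     {pair_gen f (g + g') - pair_gen f g - pair_gen f g' | f g g'. True} \<union>
     {pair_gen (qsym_scale c f) g - pair_scale c (pair_gen f g) | c f g. True} \<union>
     {pair_gen f (qsym_scale c g) - pair_scale c (pair_gen f g) | c f g. True}"

definition tensor_eq :: "'k::field pair_comb \<Rightarrow> 'k pair_comb \<Rightarrow> bool" where
  "tensor_eq x y \<longleftrightarrow> x - y \<in> pair_comb.span bilinear_relations"

lemma equivp_tensor_eq: "equivp (tensor_eq :: 'k::field pair_comb \<Rightarrow> _)"
proof (rule equivpI)
  show "reflp (tensor_eq :: 'k pair_comb \<Rightarrow> _)"
    by (simp add: reflp_def tensor_eq_def pair_comb.span_zero)
  show "symp (tensor_eq :: 'k pair_comb \<Rightarrow> _)"
    unfolding symp_def tensor_eq_def by (metis pair_comb.span_neg minus_diff_eq)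
  show "transp (tensor_eq :: 'k pair_comb \<Rightarrow> _)"
  proof (rule transpI)
    fix x y z :: "'k pair_comb"
    assume "tensor_eq x y" "tensor_eq y z"
    then show "tensor_eq x z"
      unfolding tensor_eq_def using pair_comb.span_add[of "x - y" _ "y - z"] by simp
  qed
qed

quotient_type (overloaded) 'k qsym_tensor = "'k::field pair_comb" / tensor_eq
  by (rule equivp_tensor_eq)

instantiation qsym_tensor :: (field) ab_group_add
begin

lift_definition zero_qsym_tensor :: "'a qsym_tensor" is 0 .
lift_definition plus_qsym_tensor :: "'a qsym_tensor \<Rightarrow> 'a qsym_tensor \<Rightarrow> 'a qsym_tensor" is "(+)"
proof -
  fix a b c d :: "'a pair_comb"
  assume "tensor_eq a b" "tensor_eq c d"
  then show "tensor_eq (a + c) (b + d)"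
    unfolding tensor_eq_def using pair_comb.span_add[of "a - b" _ "c - d"]
    by (simp add: algebra_simps)
qed
lift_definition uminus_qsym_tensor :: "'a qsym_tensor \<Rightarrow> 'a qsym_tensor" is uminus
proof -
  fix a b :: "'a pair_comb"
  assume "tensor_eq a b"
  then show "tensor_eq (- a) (- b)"
    unfolding tensor_eq_def using pair_comb.span_neg[of "a - b"] by simp
qed
lift_definition minus_qsym_tensor :: "'a qsym_tensor \<Rightarrow> 'a qsym_tensor \<Rightarrow> 'a qsym_tensor" is "(-)"
proof -
  fix a b c d :: "'a pair_comb"
  assume "tensor_eq a b" "tensor_eq c d"
  then show "tensor_eq (a - c) (b - d)"
    unfolding tensor_eq_def using pair_comb.span_diff[of "a - b" _ "c - d"]
    by (simp add: algebra_simps)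
qed

instance
proof
  fix a b c :: "'a qsym_tensor"
  have refl: "tensor_eq x x" for x :: "'a pair_comb"
    by (simp add: tensor_eq_def pair_comb.span_zero)
  show "a + b + c = a + (b + c)" by transfer (simp add: add.assoc refl)
  show "a + b = b + a" by transfer (simp add: add.commute refl)
  show "0 + a = a" by transfer (simp add: refl)
  show "- a + a = 0" by transfer (simp add: refl)
  show "a - b = a + - b" by transfer (simp add: refl)
qed

end

lift_definition tensor_scale :: "'k::field \<Rightarrow> 'k qsym_tensor \<Rightarrow> 'k qsym_tensor" is pair_scale
  unfolding tensor_eq_def
  by (simp only: pair_comb.scale_right_diff_distrib[symmetric] pair_comb.span_scale)

lift_definition tensor :: "'k::field qsym \<Rightarrow> 'k qsym \<Rightarrow> 'k qsym_tensor"  (infixr \<open>\<otimes>\<close> 72)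
  is pair_gen .

lemma vector_space_tensor_scale:
  "vector_space (tensor_scale :: 'k::field \<Rightarrow> 'k qsym_tensor \<Rightarrow> 'k qsym_tensor)"
proof
  have refl: "tensor_eq x x" for x :: "'k pair_comb"
    by (simp add: tensor_eq_def pair_comb.span_zero)
  fix a b :: 'k and x y :: "'k qsym_tensor"
  show "tensor_scale a (x + y) = tensor_scale a x + tensor_scale a y"
    by transfer (simp add: pair_comb.scale_right_distrib refl)
  show "tensor_scale (a + b) x = tensor_scale a x + tensor_scale b x"
    by transfer (simp add: pair_comb.scale_left_distrib refl)
  show "tensor_scale a (tensor_scale b x) = tensor_scale (a * b) x"
    by transfer (simp only: pair_comb.scale_scale refl)
  show "tensor_scale 1 x = x" by transfer (simp only: pair_comb.scale_one refl)
qed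

lemma tensor_add_left: "(f + f') \<otimes> g = f \<otimes> g + f' \<otimes> g"
  by transfer
    (unfold tensor_eq_def bilinear_relations_def diff_diff_eq[symmetric], rule pair_comb.span_base, blast)

lemma tensor_add_right: "f \<otimes> (g + g') = f \<otimes> g + f \<otimes> g'"
  by transfer
    (unfold tensor_eq_def bilinear_relations_def diff_diff_eq[symmetric], rule pair_comb.span_base, blast)

lemma tensor_scale_left: "qsym_scale c f \<otimes> g = tensor_scale c (f \<otimes> g)"
  by transfer (unfold tensor_eq_def bilinear_relations_def, rule pair_comb.span_base, blast)

lemma tensor_scale_right: "f \<otimes> qsym_scale c g = tensor_scale c (f \<otimes> g)"
  by transfer (unfold tensor_eq_def bilinear_relations_def, rule pair_comb.span_base, blast)

section \<open>The coproduct\<close>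

text \<open>The coefficient of \<open>M\<^sub>\<alpha>\<close> in a quasisymmetric function is that of the monomial
  \<open>x\<^sub>0^\<alpha>\<^sub>1 \<cdots> x\<^bsub>l-1\<^esub>^\<alpha>\<^sub>l\<close>; see \<open>qsym_expansion\<close> below.\<close>

definition QM_coeff :: "'k::comm_ring_1 qsym \<Rightarrow> nat list \<Rightarrow> 'k" where
  "QM_coeff f \<alpha> = coeff_qsym f (xpow [0..<length \<alpha>] \<alpha>)"

definition QM_support :: "'k::comm_ring_1 qsym \<Rightarrow> nat list set" where
  "QM_support f = {\<alpha>. composition \<alpha> \<and> QM_coeff f \<alpha> \<noteq> 0}"

text \<open>The linear extension of \<open>\<triangle> M\<^sub>\<alpha> = \<Sum>\<^bsub>\<beta>\<cdot>\<gamma>=\<alpha>\<^esub> M\<^sub>\<beta> \<otimes> M\<^sub>\<gamma>\<close>;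
  see \<open>linear_qsym_coproduct\<close> and \<open>qsym_coproduct_QM\<close>.\<close>

definition qsym_coproduct :: "'k::field qsym \<Rightarrow> 'k qsym_tensor" where
  "qsym_coproduct f =
     (\<Sum>\<alpha>\<in>QM_support f. tensor_scale (QM_coeff f \<alpha>)
        (\<Sum>(\<beta>, \<gamma>)\<in>{(\<beta>, \<gamma>). \<beta> @ \<gamma> = \<alpha>}. QM \<beta> \<otimes> QM \<gamma>))"

lemma QM_coeff_add: "QM_coeff (f + g) \<alpha> = QM_coeff f \<alpha> + QM_coeff g \<alpha>"
  by (simp add: QM_coeff_def plus_qsym.rep_eq)

lemma QM_coeff_scale: "QM_coeff (qsym_scale c f) \<alpha> = c * QM_coeff f \<alpha>"
  by (simp add: QM_coeff_def qsym_scale.rep_eq)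

lemma QM_coeff_zero: "QM_coeff 0 \<alpha> = 0"
  by (simp add: QM_coeff_def zero_qsym.rep_eq)

lemma QM_coeff_sum: "QM_coeff (sum F A) \<alpha> = (\<Sum>x\<in>A. QM_coeff (F x) \<alpha>)"
  by (induction A rule: infinite_finite_induct) (auto simp: QM_coeff_add QM_coeff_zero)

lemma QM_coeff_QM:
  "composition \<alpha> \<Longrightarrow> composition \<beta> \<Longrightarrow> QM_coeff (QM \<alpha>) \<beta> = (if \<alpha> = \<beta> then 1 else 0)"
  by (simp add: QM_coeff_def coeff_QM monomial_series_xpow)

lemma finite_QM_support: "finite (QM_support f)"
proof -
  obtain d where d: "\<And>m. coeff_qsym f m \<noteq> 0 \<Longrightarrow> mdeg m \<le> d"
    using coeff_qsym[of f] unfolding quasisymmetric_def by blast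
  have "QM_support f \<subseteq> {\<alpha>. set \<alpha> \<subseteq> {..d} \<and> length \<alpha> \<le> d}"
  proof
    fix \<alpha> assume \<alpha>: "\<alpha> \<in> QM_support f"
    then have "sum_list \<alpha> \<le> d"
      using d[of "xpow [0..<length \<alpha>] \<alpha>"] by (simp add: QM_support_def QM_coeff_def mdeg_xpow)
    moreover have "length \<alpha> \<le> sum_list \<alpha>"
    proof -
      have "composition \<alpha>" using \<alpha> by (simp add: QM_support_def)
      then show ?thesis by (induction \<alpha>) (auto simp: composition_def)
    qed
    moreover have "\<forall>x\<in>set \<alpha>. x \<le> sum_list \<alpha>" by (simp add: member_le_sum_list)
    ultimately show "\<alpha> \<in> {\<alpha>. set \<alpha> \<subseteq> {..d} \<and> length \<alpha> \<le> d}" by fastforce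
  qed
  then show ?thesis using finite_lists_length_le finite_subset by blast
qed

lemma qsym_eqI:
  assumes "\<And>\<alpha>. composition \<alpha> \<Longrightarrow> QM_coeff f \<alpha> = QM_coeff g \<alpha>"
  shows "f = g"
proof -
  have "coeff_qsym f m = coeff_qsym g m" for m
  proof -
    let ?is = "sorted_list_of_set (Poly_Mapping.keys m)"
    let ?\<alpha> = "map (Poly_Mapping.lookup m) ?is"
    have m: "m = xpow ?is ?\<alpha>" using xpow_map_lookup[of ?is m] by simp
    have c: "composition ?\<alpha>" by (auto simp: composition_def in_keys_iff)
    have "coeff_qsym h (xpow ?is ?\<alpha>) = QM_coeff h ?\<alpha>" for h :: "'a qsym"
    proof -
      have "quasisymmetric (coeff_qsym h)" using coeff_qsym[of h] by simp
      then show ?thesis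
        unfolding QM_coeff_def by (rule quasisymmetric_weak) auto
    qed
    from this[of f] this[of g] show ?thesis using assms[OF c] m by simp
  qed
  then show ?thesis by (simp add: coeff_qsym_inject[symmetric] fun_eq_iff)
qed

lemma qsym_expansion: "f = (\<Sum>\<alpha>\<in>QM_support f. qsym_scale (QM_coeff f \<alpha>) (QM \<alpha>))"
proof (rule qsym_eqI)
  fix \<beta> assume \<beta>: "composition \<beta>"
  have "QM_coeff (\<Sum>\<alpha>\<in>QM_support f. qsym_scale (QM_coeff f \<alpha>) (QM \<alpha>)) \<beta>
      = (\<Sum>\<alpha>\<in>QM_support f. if \<alpha> = \<beta> then QM_coeff f \<beta> else 0)"
    unfolding QM_coeff_sum using \<beta>
    by (intro sum.cong) (auto simp: QM_coeff_scale QM_coeff_QM QM_support_def)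
  also have "\<dots> = QM_coeff f \<beta>"
    unfolding sum.delta[OF finite_QM_support] using \<beta> by (simp add: QM_support_def)
  finally show "QM_coeff f \<beta> = QM_coeff (\<Sum>\<alpha>\<in>QM_support f. qsym_scale (QM_coeff f \<alpha>) (QM \<alpha>)) \<beta>" ..
qed

lemma qsym_coproduct_superset:
  assumes "finite A" "QM_support f \<subseteq> A" "\<forall>\<alpha>\<in>A. composition \<alpha>"
  shows "qsym_coproduct f =
     (\<Sum>\<alpha>\<in>A. tensor_scale (QM_coeff f \<alpha>)
        (\<Sum>(\<beta>, \<gamma>)\<in>{(\<beta>, \<gamma>). \<beta> @ \<gamma> = \<alpha>}. QM \<beta> \<otimes> QM \<gamma>))"
proof -
  interpret T: vector_space "tensor_scale :: 'a \<Rightarrow> 'a qsym_tensor \<Rightarrow> 'a qsym_tensor"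
    by (rule vector_space_tensor_scale)
  show ?thesis
    unfolding qsym_coproduct_def using assms
    by (intro sum.mono_neutral_left) (auto simp: QM_support_def)
qed

lemma linear_qsym_coproduct:
  "Vector_Spaces.linear qsym_scale tensor_scale (qsym_coproduct :: 'k::field qsym \<Rightarrow> _)"
proof -
  interpret Q: vector_space "qsym_scale :: 'k \<Rightarrow> 'k qsym \<Rightarrow> 'k qsym"
    by (rule vector_space_qsym_scale)
  interpret T: vector_space "tensor_scale :: 'k \<Rightarrow> 'k qsym_tensor \<Rightarrow> 'k qsym_tensor"
    by (rule vector_space_tensor_scale)
  show ?thesis
  proof
    fix f g :: "'k qsym" and c :: 'k
    let ?A = "QM_support f \<union> QM_support g"
    have A: "finite ?A" "\<forall>\<alpha>\<in>?A. composition \<alpha>"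
      by (auto simp: finite_QM_support) (auto simp: QM_support_def)
    have sub: "QM_support (f + g) \<subseteq> ?A" "QM_support (qsym_scale c f) \<subseteq> ?A"
        "QM_support f \<subseteq> ?A" "QM_support g \<subseteq> ?A"
      by (auto simp: QM_support_def QM_coeff_add QM_coeff_scale)
    note cop = sub[THEN qsym_coproduct_superset[OF A(1) _ A(2)]]
    show "qsym_coproduct (f + g) = qsym_coproduct f + qsym_coproduct g"
      unfolding cop QM_coeff_add T.scale_left_distrib sum.distrib ..
    show "qsym_coproduct (qsym_scale c f) = tensor_scale c (qsym_coproduct f)"
      unfolding cop QM_coeff_scale T.scale_sum_right T.scale_scale ..
  qed
qed

lemma qsym_coproduct_QM:
  assumes "composition \<alpha>"
  shows "qsym_coproduct (QM \<alpha>) = (\<Sum>(\<beta>, \<gamma>)\<in>{(\<beta>, \<gamma>). \<beta> @ \<gamma> = \<alpha>}. QM \<beta> \<otimes> (QM \<gamma> :: 'k::field qsym))"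
proof -
  interpret T: vector_space "tensor_scale :: 'k \<Rightarrow> 'k qsym_tensor \<Rightarrow> 'k qsym_tensor"
    by (rule vector_space_tensor_scale)
  have "QM_support (QM \<alpha> :: 'k qsym) \<subseteq> {\<alpha>}"
    using assms by (auto simp: QM_support_def QM_coeff_QM split: if_splits)
  then show ?thesis
    using assms by (simp add: qsym_coproduct_superset[of "{\<alpha>}"] QM_coeff_QM)
qed

section \<open>The functions \<open>\<D>\<^sub>\<alpha>(q,t)\<close>\<close>

definition D_qsym :: "'k::field \<Rightarrow> 'k \<Rightarrow> nat list \<Rightarrow> 'k qsym" where
  "D_qsym q t \<alpha> =
     (\<Sum>\<beta>\<in>{\<beta>. refines \<alpha> \<beta>}.
        qsym_scale (q powi (int (length \<beta>) - int (sum_list \<alpha>)) * (- t) ^ (length \<alpha> - length \<beta>)) (QM \<beta>))"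

lemma finite_refines: "finite {\<beta>. refines \<alpha> \<beta>}"
proof -
  have "{\<beta>. refines \<alpha> \<beta>} \<subseteq> {\<beta>. set \<beta> \<subseteq> {..sum_list \<alpha>} \<and> length \<beta> \<le> length \<alpha>}"
  proof safe
    fix \<beta> assume "refines \<alpha> \<beta>"
    then obtain bl where bl: "[] \<notin> set bl" "concat bl = \<alpha>" "map sum_list bl = \<beta>"
      by (auto simp: refines_def)
    have "sum_list (concat bl) = sum_list (map sum_list bl)" by (induction bl) auto
    then have "sum_list \<beta> = sum_list \<alpha>" using bl by simp
    then show "x \<le> sum_list \<alpha>" if "x \<in> set \<beta>" for x
      using that \<open>sum_list \<beta> = sum_list \<alpha>\<close> member_le_sum_list[of x \<beta>] by simp
    have "length bl \<le> length (concat bl)"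
      using bl(1)
    proof (induction bl)
      case (Cons b bl)
      then show ?case by (cases b) auto
    qed auto
    then show "length \<beta> \<le> length \<alpha>" using bl by auto
  qed
  then show ?thesis using finite_lists_length_le finite_subset by blast
qed

text \<open>\<open>\<complex>(q,t)\<close> as the fraction field of \<open>\<complex>[q][t]\<close>.\<close>

type_synonym Cqt = "complex poly poly fract"

definition q_var :: Cqt where
  "q_var = Fraction_Field.Fract [:[:0, 1:]:] 1"

definition t_var :: Cqt where
  "t_var = Fraction_Field.Fract [:0, 1:] 1"

section \<open>Two-way overlapping shuffles\<close>

datatype separator = Comma | Plus1 | Plus2

text \<open>An expression \<open>a\<^sub>0 s\<^sub>0 a\<^sub>1 s\<^sub>1 \<dots> a\<^sub>n\<close> is stored as its list of entries
  together with its list of separators, which is one shorter (both empty if there are no entries).\<close>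

type_synonym expression = "nat list \<times> separator list"

definition shuffle_word :: "nat set \<Rightarrow> nat list \<Rightarrow> nat list \<Rightarrow> nat list" where
  "shuffle_word D \<alpha> \<beta> =
     map (\<lambda>p. if p \<in> D then \<beta> ! card {i. i < p \<and> i \<in> D} else \<alpha> ! card {i. i < p \<and> i \<notin> D})
       [0..<length \<alpha> + length \<beta>]"

text \<open>Comma \<open>i\<close> stands between the positions \<open>i\<close> and \<open>i + 1\<close>; position \<open>p\<close> carries a part of \<open>\<beta>\<close>
  iff \<open>p \<in> D\<close>.  The set \<open>R\<close> contains the commas that are replaced.\<close>

definition replaceable_commas :: "nat set \<Rightarrow> nat \<Rightarrow> nat set" where
  "replaceable_commas D n = {i. Suc i < n \<and> (i \<in> D) \<noteq> (Suc i \<in> D)}"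

definition shuffle_separators :: "nat set \<Rightarrow> nat set \<Rightarrow> nat \<Rightarrow> separator list" where
  "shuffle_separators D R n =
     map (\<lambda>i. if i \<notin> R then Comma else if i \<in> D then Plus2 else Plus1) [0..<n - 1]"

definition two_way_overlapping_shuffles :: "nat list \<Rightarrow> nat list \<Rightarrow> expression multiset" where
  "two_way_overlapping_shuffles \<alpha> \<beta> =
     (let n = length \<alpha> + length \<beta> in
      image_mset (\<lambda>(D, R). (shuffle_word D \<alpha> \<beta>, shuffle_separators D R n))
        (mset_set {(D, R). D \<subseteq> {..<n} \<and> card D = length \<beta> \<and> R \<subseteq> replaceable_commas D n}))"

lemma finite_shuffle_choices:
  "finite {(D, R). D \<subseteq> {..<n} \<and> card D = k \<and> R \<subseteq> replaceable_commas D n}"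
  by (rule finite_subset[of _ "Pow {..<n} \<times> Pow {..<n}"]) (auto simp: replaceable_commas_def)

fun add_up :: "nat list \<Rightarrow> separator list \<Rightarrow> nat list" where
  "add_up (x # y # xs) (s # ss) =
     (if s = Comma then x # add_up (y # xs) ss else add_up ((x + y) # xs) ss)"
| "add_up xs ss = xs"

definition plus_composition :: "expression \<Rightarrow> nat list" where
  "plus_composition \<gamma> = add_up (fst \<gamma>) (snd \<gamma>)"

definition c1 :: "expression \<Rightarrow> nat" where
  "c1 \<gamma> = count_list (snd \<gamma>) Plus1"

definition c2 :: "expression \<Rightarrow> nat" where
  "c2 \<gamma> = count_list (snd \<gamma>) Plus2"

end

theory Submission
  imports Defs
begin

text \<open>
  Both formulas follow from the behaviour of \<open>\<D>\<^sub>\<alpha>\<close> under splitting off the first variable.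
  In one variable \<open>\<D>\<^sub>\<mu>(x) = q^(1-n) (-t)^(l-1) x^n\<close> for \<open>\<mu>\<close> with \<open>l > 0\<close> parts and sum \<open>n\<close>, while
  \<open>\<D>\<close> of the empty composition is \<open>1\<close>, and
  \<open>\<D>\<^sub>\<alpha>(x\<^sub>0, x\<^sub>1, \<dots>) = \<Sum>\<^bsub>\<mu>\<cdot>\<nu>=\<alpha>\<^esub> \<D>\<^sub>\<mu>(x\<^sub>0) \<D>\<^sub>\<nu>(x\<^sub>1, x\<^sub>2, \<dots>)\<close>.
  So a coefficient of \<open>\<D>\<^sub>\<alpha>\<close> is a sum over the ways to distribute consecutive blocks of \<open>\<alpha>\<close> on the
  variables (\<open>D_coeff\<close>, \<open>coeff_D_qsym_xpow\<close>).  For the coproduct, cut the sequence of variables in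
  two: the blocks before the cut form \<open>\<alpha>\<close> and those after it form \<open>\<beta>\<close>, with \<open>\<alpha> \<cdot> \<beta> = \<gamma>\<close>
  (\<open>D_coeff_append\<close>).

  For the product, fix the word of a shuffle and sum over its separators.  Two neighbouring letters
  go to the same variable either because their comma stays and \<open>\<D>\<close> puts both into one block, with
  factor \<open>- t\<close>, or because the comma was replaced.  The total weight of this is \<open>- t\<close> for two letters
  of the same composition, \<open>- t + (q + t) = q\<close> for a part of \<open>\<alpha>\<close> before a part of \<open>\<beta>\<close>, and
  \<open>- t + t = 0\<close> for a part of \<open>\<beta>\<close> before a part of \<open>\<alpha>\<close> (\<open>sum_separators\<close>).  Thus only blocks survive
  that consist of a run \<open>\<mu>\<close> of \<open>\<alpha>\<close> followed by a run \<open>\<nu>\<close> of \<open>\<beta>\<close>, and their weight is the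
  coefficient in \<open>\<D>\<^sub>\<mu>(x) \<D>\<^sub>\<nu>(x)\<close>.  What remains is a sum over pairs of distributions of \<open>\<alpha>\<close> and \<open>\<beta>\<close>
  on the variables, which is the coefficient of \<open>\<D>\<^sub>\<alpha> \<D>\<^sub>\<beta>\<close> (\<open>total_coeff_eq_product_coeff\<close>).
\<close>

section \<open>Compositions and refinement\<close>

lemma composition_simps [simp]:
  "composition []" "composition (a # \<alpha>) \<longleftrightarrow> 0 < a \<and> composition \<alpha>"
  "composition (\<alpha> @ \<beta>) \<longleftrightarrow> composition \<alpha> \<and> composition \<beta>"
  by (auto simp: composition_def)

lemma length_le_sum_list: "composition \<alpha> \<Longrightarrow> length \<alpha> \<le> sum_list \<alpha>"
  by (induction \<alpha>) auto

definition compositions_upto :: "nat \<Rightarrow> nat list set" where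
  "compositions_upto N = {\<alpha>. composition \<alpha> \<and> sum_list \<alpha> \<le> N}"

lemma finite_compositions_upto: "finite (compositions_upto N)"
proof -
  have "compositions_upto N \<subseteq> {\<alpha>. set \<alpha> \<subseteq> {..N} \<and> length \<alpha> \<le> N}"
    using length_le_sum_list member_le_sum_list by (fastforce simp: compositions_upto_def)
  then show ?thesis using finite_lists_length_le finite_subset by blast
qed

lemma refines_Nil [simp]: "refines \<alpha> [] \<longleftrightarrow> \<alpha> = []"
  by (auto simp: refines_def)

lemma refines_Cons:
  "refines \<alpha> (g # \<beta>) \<longleftrightarrow> (\<exists>a \<mu> \<nu>. \<alpha> = a # \<mu> @ \<nu> \<and> g = a + sum_list \<mu> \<and> refines \<nu> \<beta>)"
proof
  assume "refines \<alpha> (g # \<beta>)"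
  then obtain b bs where *: "[] \<notin> set (b # bs)" "concat (b # bs) = \<alpha>" "sum_list b = g" "map sum_list bs = \<beta>"
    unfolding refines_def by (auto simp: Cons_eq_map_conv map_eq_Cons_conv)
  then obtain a \<mu> where "b = a # \<mu>" by (cases b) auto
  with * show "\<exists>a \<mu> \<nu>. \<alpha> = a # \<mu> @ \<nu> \<and> g = a + sum_list \<mu> \<and> refines \<nu> \<beta>"
    unfolding refines_def by (intro exI[of _ a] exI[of _ \<mu>] exI[of _ "concat bs"]) auto
next
  assume "\<exists>a \<mu> \<nu>. \<alpha> = a # \<mu> @ \<nu> \<and> g = a + sum_list \<mu> \<and> refines \<nu> \<beta>"
  then obtain a \<mu> bs where "\<alpha> = a # \<mu> @ concat bs" "g = a + sum_list \<mu>" "[] \<notin> set bs" "map sum_list bs = \<beta>"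
    unfolding refines_def by auto
  then show "refines \<alpha> (g # \<beta>)"
    unfolding refines_def by (intro exI[of _ "(a # \<mu>) # bs"]) auto
qed

lemma refines_length: "refines \<alpha> \<beta> \<Longrightarrow> length \<beta> \<le> length \<alpha>"
  by (induction \<beta> arbitrary: \<alpha>) (fastforce simp: refines_Cons)+

lemma refines_sum_list: "refines \<alpha> \<beta> \<Longrightarrow> sum_list \<beta> = sum_list \<alpha>"
  by (induction \<beta> arbitrary: \<alpha>) (fastforce simp: refines_Cons)+

lemma refines_composition: "refines \<alpha> \<beta> \<Longrightarrow> composition \<alpha> \<Longrightarrow> composition \<beta>"
  by (induction \<beta> arbitrary: \<alpha>) (fastforce simp: refines_Cons)+

section \<open>Sums over cuts of a list and over subsets\<close>

text \<open>A cut of \<open>c # \<gamma>\<close> is the one at the front or comes from a cut of \<open>\<gamma>\<close>; the sums over cuts below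
  are evaluated by recursion along this description.\<close>

definition splits :: "nat list \<Rightarrow> (nat list \<times> nat list) set" where
  "splits \<gamma> = {(\<alpha>, \<beta>). \<alpha> @ \<beta> = \<gamma>}"

lemma splits_Nil [simp]: "splits [] = {([], [])}"
  by (auto simp: splits_def)

lemma splits_Cons: "splits (c # \<gamma>) = insert ([], c # \<gamma>) (map_prod (Cons c) id ` splits \<gamma>)"
  by (auto simp: splits_def append_eq_Cons_conv intro: rev_image_eqI)

lemma finite_splits [simp]: "finite (splits \<gamma>)"
  by (induction \<gamma>) (auto simp: splits_Cons)

lemma sum_splits_Cons:
  fixes F :: "nat list \<Rightarrow> nat list \<Rightarrow> 'b::comm_monoid_add"
  shows "(\<Sum>(\<alpha>, \<beta>)\<in>splits (c # \<gamma>). F \<alpha> \<beta>) = F [] (c # \<gamma>) + (\<Sum>(\<alpha>, \<beta>)\<in>splits \<gamma>. F (c # \<alpha>) \<beta>)"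
proof -
  have "inj_on (map_prod (Cons c) id) (splits \<gamma>)" by (auto simp: inj_on_def)
  then show ?thesis
    unfolding splits_Cons by (subst sum.insert) (auto simp: sum.reindex case_prod_unfold)
qed

lemma sum_Pow_Suc:
  fixes F :: "nat set \<Rightarrow> 'b::comm_monoid_add"
  shows "(\<Sum>R\<in>Pow (Suc ` A). F R) = (\<Sum>R\<in>Pow A. F (Suc ` R))"
proof -
  have P: "Pow (Suc ` A) = (`) Suc ` Pow A" by (simp add: image_Pow_surj)
  have inj: "inj_on ((`) Suc) (Pow A)" by (auto simp: inj_on_def inj_image_eq_iff)
  show ?thesis by (simp add: P sum.reindex inj)
qed

lemma sum_Pow_insert_0_Suc:
  fixes F :: "nat set \<Rightarrow> 'b::comm_monoid_add"
  assumes "finite A"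
  shows "(\<Sum>R\<in>Pow (insert 0 (Suc ` A)). F R) =
    (\<Sum>R\<in>Pow A. F (Suc ` R)) + (\<Sum>R\<in>Pow A. F (insert 0 (Suc ` R)))"
proof -
  have "inj_on (insert 0) (Pow (Suc ` A))"
    by (rule inj_on_inverseI[where g = "\<lambda>R. R - {0}"]) auto
  then have "(\<Sum>R\<in>insert 0 ` Pow (Suc ` A). F R) = (\<Sum>R\<in>Pow (Suc ` A). F (insert 0 R))"
    by (simp add: sum.reindex)
  moreover have "(\<Sum>R\<in>Pow (insert 0 (Suc ` A)). F R) =
      (\<Sum>R\<in>Pow (Suc ` A). F R) + (\<Sum>R\<in>insert 0 ` Pow (Suc ` A). F R)"
    unfolding Pow_insert using assms by (intro sum.union_disjoint) auto
  ultimately show ?thesis by (simp only: sum_Pow_Suc)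
qed

lemma sum_subsets_Suc:
  fixes F :: "nat set \<Rightarrow> 'b::comm_monoid_add"
  shows "(\<Sum>D\<in>{D. D \<subseteq> {..<Suc m} \<and> card D = k}. F D) =
    (\<Sum>D\<in>{D. D \<subseteq> {..<m} \<and> card D = k}. F (Suc ` D)) +
    (\<Sum>D\<in>{D. D \<subseteq> {..<m} \<and> Suc (card D) = k}. F (insert 0 (Suc ` D)))"
proof -
  have filter: "(\<Sum>D\<in>{D. D \<subseteq> {..<m} \<and> P D}. G D) = (\<Sum>D\<in>Pow {..<m}. if P D then G D else 0)"
    for m P and G :: "nat set \<Rightarrow> 'b"
    using sum.inter_filter[of "Pow {..<m}" G P] by (simp add: Pow_def)
  have card: "card (insert 0 (Suc ` D)) = Suc (card D)" if "D \<in> Pow {..<m}" for D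
    using that by (subst card_insert_disjoint) (auto simp: card_image intro: finite_subset)
  show ?thesis
    unfolding filter
    unfolding lessThan_Suc_eq_insert_0
    by (subst sum_Pow_insert_0_Suc) (auto simp: card_image card intro!: sum.cong arg_cong2[of _ _ _ _ "(+)"])
qed

section \<open>The monomial basis, products and tensors\<close>

text \<open>Variables with exponent \<open>0\<close> may be dropped, so the coefficient at any exponent sequence, zeros
  included, is a coefficient in the expansion by monomial quasisymmetric functions.  This is needed since the
  two factors of a monomial with positive exponents may have exponents \<open>0\<close>.\<close>

lemma coeff_qsym_xpow:
  fixes f :: "'k::comm_ring_1 qsym"
  assumes "length is = length us" "sorted_wrt (<) is"
  shows "coeff_qsym f (xpow is us) = QM_coeff f (filter (\<lambda>u. u \<noteq> 0) us)"
proof -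
  have "\<exists>js. length js = length (filter (\<lambda>u. u \<noteq> 0) us) \<and> sorted_wrt (<) js \<and> set js \<subseteq> set is
      \<and> xpow js (filter (\<lambda>u. u \<noteq> 0) us) = xpow is us"
    using assms
  proof (induction "is" us rule: list_induct2)
    case (Cons i "is" u us)
    then obtain js where js: "length js = length (filter (\<lambda>u. u \<noteq> 0) us)" "sorted_wrt (<) js" "set js \<subseteq> set is"
      "xpow js (filter (\<lambda>u. u \<noteq> 0) us) = xpow is us" by auto
    show ?case
    proof (cases "u = 0")
      case True
      then show ?thesis using js by (intro exI[of _ js]) auto
    next
      case False
      then show ?thesis using js Cons.prems by (intro exI[of _ "i # js"]) auto
    qed
  qed auto
  then obtain js where js: "length js = length (filter (\<lambda>u. u \<noteq> 0) us)" "sorted_wrt (<) js"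
    "xpow js (filter (\<lambda>u. u \<noteq> 0) us) = xpow is us" by auto
  have "coeff_qsym f (xpow js (filter (\<lambda>u. u \<noteq> 0) us)) = QM_coeff f (filter (\<lambda>u. u \<noteq> 0) us)"
    unfolding QM_coeff_def
    by (rule quasisymmetric_weak) (use coeff_qsym[of f] js in auto)
  then show ?thesis using js by simp
qed

text \<open>The pairs of exponent sequences of two monomials with product exponents \<open>gs\<close>.\<close>

definition sum_pairs :: "nat list \<Rightarrow> (nat list \<times> nat list) set" where
  "sum_pairs gs = {(us, vs). length us = length gs \<and> length vs = length gs \<and> map2 (+) us vs = gs}"

lemma sum_pairs_Nil [simp]: "sum_pairs [] = {([], [])}"
  by (auto simp: sum_pairs_def)

lemma sum_pairs_Cons:
  "sum_pairs (g # gs) = (\<lambda>(u, us, vs). (u # us, (g - u) # vs)) ` ({..g} \<times> sum_pairs gs)"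
proof -
  have "p \<in> (\<lambda>(u, us, vs). (u # us, (g - u) # vs)) ` ({..g} \<times> sum_pairs gs)"
    if "p \<in> sum_pairs (g # gs)" for p
  proof -
    obtain xs ys where "p = (xs, ys)" by (cases p)
    moreover from this that obtain u us v vs where "xs = u # us" "ys = v # vs"
      by (cases xs; cases ys) (auto simp: sum_pairs_def)
    ultimately have "p = (u # us, v # vs)" "u + v = g" "(us, vs) \<in> sum_pairs gs"
      using that by (auto simp: sum_pairs_def)
    then show ?thesis by (auto intro!: rev_image_eqI[of "(u, us, vs)"])
  qed
  moreover have "(\<lambda>(u, us, vs). (u # us, (g - u) # vs)) ` ({..g} \<times> sum_pairs gs) \<subseteq> sum_pairs (g # gs)"
  proof
    fix p assume "p \<in> (\<lambda>(u, us, vs). (u # us, (g - u) # vs)) ` ({..g} \<times> sum_pairs gs)"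
    then obtain u us vs where "p = (u # us, (g - u) # vs)" "u \<le> g" "(us, vs) \<in> sum_pairs gs"
      by auto
    then show "p \<in> sum_pairs (g # gs)" by (simp add: sum_pairs_def)
  qed
  ultimately show ?thesis by blast
qed

lemma sum_sum_pairs_Cons:
  fixes F :: "nat list \<Rightarrow> nat list \<Rightarrow> 'b::comm_monoid_add"
  shows "(\<Sum>(us, vs)\<in>sum_pairs (g # gs). F us vs) =
    (\<Sum>u\<le>g. \<Sum>(us, vs)\<in>sum_pairs gs. F (u # us) ((g - u) # vs))"
proof -
  have "inj_on (\<lambda>(u, us, vs). (u # us, (g - u) # vs)) ({..g} \<times> sum_pairs gs)"
    by (auto simp: inj_on_def)
  then show ?thesis
    unfolding sum_pairs_Cons
    by (simp add: sum.reindex case_prod_unfold sum.cartesian_product)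
qed

lemma tensor_sum_left: "(\<Sum>i\<in>I. F i) \<otimes> g = (\<Sum>i\<in>I. F i \<otimes> g)"
proof -
  have "0 \<otimes> g = 0" using tensor_add_left[of 0 0 g] by simp
  then show ?thesis by (induction I rule: infinite_finite_induct) (auto simp: tensor_add_left)
qed

lemma tensor_sum_right: "f \<otimes> (\<Sum>i\<in>I. F i) = (\<Sum>i\<in>I. f \<otimes> F i)"
proof -
  have "f \<otimes> 0 = 0" using tensor_add_right[of f 0 0] by simp
  then show ?thesis by (induction I rule: infinite_finite_induct) (auto simp: tensor_add_right)
qed

section \<open>Shuffles read from the first letter\<close>

text \<open>A shuffle as a list of its entries, each with the information whether it comes from \<open>\<beta>\<close>.  The
  weight of a separator depends on the marks of its two neighbours.\<close>

definition label :: "nat set \<Rightarrow> nat list \<Rightarrow> (bool \<times> nat) list" where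
  "label D xs = zip (map (\<lambda>i. i \<in> D) [0..<length xs]) xs"

lemma label_Nil [simp]: "label D [] = []"
  by (simp add: label_def)

lemma upt_Suc_map: "[0..<Suc n] = 0 # map Suc [0..<n]"
  by (simp add: map_Suc_upt upt_conv_Cons)

lemma label_Cons: "label D (x # xs) = (0 \<in> D, x) # label {i. Suc i \<in> D} xs"
  by (simp add: label_def upt_Suc_map comp_def del: upt_Suc)

lemma label_Suc:
  "label (Suc ` D) (x # xs) = (False, x) # label D xs"
  "label (insert 0 (Suc ` D)) (x # xs) = (True, x) # label D xs"
proof -
  have "{i. Suc i \<in> Suc ` D} = D" "{i. Suc i \<in> insert 0 (Suc ` D)} = D" by auto
  then show "label (Suc ` D) (x # xs) = (False, x) # label D xs"
    "label (insert 0 (Suc ` D)) (x # xs) = (True, x) # label D xs"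
    unfolding label_Cons by auto
qed

lemma card_below_Suc:
  "card {i. i < Suc p \<and> i \<in> Suc ` D} = card {i. i < p \<and> i \<in> D}"
  "card {i. i < Suc p \<and> i \<notin> Suc ` D} = Suc (card {i. i < p \<and> i \<notin> D})"
  "card {i. i < Suc p \<and> i \<in> insert 0 (Suc ` D)} = Suc (card {i. i < p \<and> i \<in> D})"
  "card {i. i < Suc p \<and> i \<notin> insert 0 (Suc ` D)} = card {i. i < p \<and> i \<notin> D}"
proof -
  have *: "{i. i < Suc p \<and> i \<in> Suc ` D} = Suc ` {i. i < p \<and> i \<in> D}"
    "{i. i < Suc p \<and> i \<notin> Suc ` D} = insert 0 (Suc ` {i. i < p \<and> i \<notin> D})"
    "{i. i < Suc p \<and> i \<in> insert 0 (Suc ` D)} = insert 0 (Suc ` {i. i < p \<and> i \<in> D})"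
    "{i. i < Suc p \<and> i \<notin> insert 0 (Suc ` D)} = Suc ` {i. i < p \<and> i \<notin> D}"
    by (auto simp: image_iff less_Suc_eq_0_disj)
  show "card {i. i < Suc p \<and> i \<in> Suc ` D} = card {i. i < p \<and> i \<in> D}"
    "card {i. i < Suc p \<and> i \<notin> insert 0 (Suc ` D)} = card {i. i < p \<and> i \<notin> D}"
    unfolding * by (simp_all add: card_image)
  show "card {i. i < Suc p \<and> i \<notin> Suc ` D} = Suc (card {i. i < p \<and> i \<notin> D})"
    "card {i. i < Suc p \<and> i \<in> insert 0 (Suc ` D)} = Suc (card {i. i < p \<and> i \<in> D})"
    unfolding * by (simp_all add: card_image card_insert_disjoint)
qed

lemma shuffle_word_Suc:
  "shuffle_word (Suc ` D) (a # \<alpha>) \<beta> = a # shuffle_word D \<alpha> \<beta>"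
  "shuffle_word (insert 0 (Suc ` D)) \<alpha> (b # \<beta>) = b # shuffle_word D \<alpha> \<beta>"
proof -
  have n: "length (a # \<alpha>) + length \<beta> = Suc (length \<alpha> + length \<beta>)"
    "length \<alpha> + length (b # \<beta>) = Suc (length \<alpha> + length \<beta>)" by simp_all
  show "shuffle_word (Suc ` D) (a # \<alpha>) \<beta> = a # shuffle_word D \<alpha> \<beta>"
    unfolding shuffle_word_def n upt_Suc_map
    by (auto simp: comp_def card_below_Suc)
  show "shuffle_word (insert 0 (Suc ` D)) \<alpha> (b # \<beta>) = b # shuffle_word D \<alpha> \<beta>"
    unfolding shuffle_word_def n upt_Suc_map list.map list.map_comp comp_def card_below_Suc
    by auto
qed

definition shuffle_sum :: "nat list \<Rightarrow> nat list \<Rightarrow> ((bool \<times> nat) list \<Rightarrow> 'b::comm_monoid_add) \<Rightarrow> 'b" where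
  "shuffle_sum \<alpha> \<beta> F =
     (\<Sum>D\<in>{D. D \<subseteq> {..<length \<alpha> + length \<beta>} \<and> card D = length \<beta>}. F (label D (shuffle_word D \<alpha> \<beta>)))"

lemma shuffle_sum_Nil: "shuffle_sum [] [] F = F []"
proof -
  have "{D::nat set. D \<subseteq> {} \<and> card D = 0} = {{}}" by auto
  then show ?thesis by (simp add: shuffle_sum_def shuffle_word_def)
qed

text \<open>Sorting the sets \<open>D\<close> by whether they contain \<open>0\<close> turns the sum over position sets into the usual
  recursion for shuffles: the first letter is the first part of \<open>\<alpha>\<close> or the first part of \<open>\<beta>\<close>.\<close>

lemma shuffle_sum_first:
  "shuffle_sum \<alpha> \<beta> F =
    (case \<alpha> of [] \<Rightarrow> if \<beta> = [] then F [] else 0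
     | a # \<alpha>' \<Rightarrow> shuffle_sum \<alpha>' \<beta> (\<lambda>w. F ((False, a) # w))) +
    (case \<beta> of [] \<Rightarrow> 0 | b # \<beta>' \<Rightarrow> shuffle_sum \<alpha> \<beta>' (\<lambda>w. F ((True, b) # w)))"
proof (cases "\<alpha> = [] \<and> \<beta> = []")
  case True
  then show ?thesis by (simp add: shuffle_sum_Nil)
next
  case False
  then obtain m where m: "length \<alpha> + length \<beta> = Suc m" by (cases \<alpha>; cases \<beta>) auto
  have "(\<Sum>D\<in>{D. D \<subseteq> {..<m} \<and> card D = length \<beta>}. F (label (Suc ` D) (shuffle_word (Suc ` D) \<alpha> \<beta>))) =
    (case \<alpha> of [] \<Rightarrow> 0 | a # \<alpha>' \<Rightarrow> shuffle_sum \<alpha>' \<beta> (\<lambda>w. F ((False, a) # w)))"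
  proof (cases \<alpha>)
    case Nil
    have "\<not> (D \<subseteq> {..<m} \<and> card D = length \<beta>)" for D
      using card_mono[of "{..<m}" D] m Nil by auto
    then show ?thesis using Nil by (simp only:) simp
  next
    case (Cons a \<alpha>')
    then show ?thesis using m by (simp add: shuffle_sum_def shuffle_word_Suc label_Suc)
  qed
  moreover have "(\<Sum>D\<in>{D. D \<subseteq> {..<m} \<and> Suc (card D) = length \<beta>}.
      F (label (insert 0 (Suc ` D)) (shuffle_word (insert 0 (Suc ` D)) \<alpha> \<beta>))) =
    (case \<beta> of [] \<Rightarrow> 0 | b # \<beta>' \<Rightarrow> shuffle_sum \<alpha> \<beta>' (\<lambda>w. F ((True, b) # w)))"
  proof (cases \<beta>)
    case (Cons b \<beta>')
    then show ?thesis using m by (simp add: shuffle_sum_def shuffle_word_Suc label_Suc)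
  qed simp
  ultimately show ?thesis
    using False unfolding shuffle_sum_def[of \<alpha> \<beta>] m sum_subsets_Suc by (auto split: list.split)
qed

lemma shuffle_sum_add: "shuffle_sum \<alpha> \<beta> (\<lambda>w. F w + G w) = shuffle_sum \<alpha> \<beta> F + shuffle_sum \<alpha> \<beta> G"
  by (simp add: shuffle_sum_def sum.distrib)

lemma shuffle_sum_scale: "shuffle_sum \<alpha> \<beta> (\<lambda>w. (c :: 'b::semiring_0) * F w) = c * shuffle_sum \<alpha> \<beta> F"
  by (simp add: shuffle_sum_def sum_distrib_left)

lemma shuffle_sum_0: "shuffle_sum \<alpha> \<beta> (\<lambda>w. 0) = 0"
  by (simp add: shuffle_sum_def)

lemma composition_shuffle_word:
  assumes "composition \<alpha>" "composition \<beta>" "D \<subseteq> {..<length \<alpha> + length \<beta>}" "card D = length \<beta>"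
  shows "composition (shuffle_word D \<alpha> \<beta>)"
proof -
  let ?n = "length \<alpha> + length \<beta>"
  have fin: "finite D" using assms finite_subset by blast
  have co: "card ({..<?n} - D) = length \<alpha>" using assms fin by (simp add: card_Diff_subset)
  have "card {i. i < p \<and> i \<in> D} < length \<beta>" if "p \<in> D" for p
    unfolding assms(4)[symmetric] using that fin by (intro psubset_card_mono) auto
  moreover have "card {i. i < p \<and> i \<notin> D} < length \<alpha>" if "p \<notin> D" "p < ?n" for p
  proof -
    have "card {i. i < p \<and> i \<notin> D} < card ({..<?n} - D)"
      using that by (intro psubset_card_mono) auto
    then show ?thesis by (simp only: co)
  qed
  ultimately show ?thesis
    using assms(1,2) by (auto simp: shuffle_word_def composition_def)
qed

lemma finite_replaceable_commas: "finite (replaceable_commas D n)"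
  by (rule finite_subset[of _ "{..<n}"]) (auto simp: replaceable_commas_def)

lemma replaceable_commas_Suc:
  "replaceable_commas D (Suc (Suc n)) =
    (if (0 \<in> D) = (1 \<in> D) then Suc ` replaceable_commas {i. Suc i \<in> D} (Suc n)
     else insert 0 (Suc ` replaceable_commas {i. Suc i \<in> D} (Suc n)))"
proof (rule set_eqI)
  fix i
  have "0 \<in> replaceable_commas D (Suc (Suc n)) \<longleftrightarrow> (0 \<in> D) \<noteq> (1 \<in> D)"
    "Suc j \<in> replaceable_commas D (Suc (Suc n)) \<longleftrightarrow> j \<in> replaceable_commas {i. Suc i \<in> D} (Suc n)" for j
    by (auto simp: replaceable_commas_def)
  then show "i \<in> replaceable_commas D (Suc (Suc n)) \<longleftrightarrow>
    i \<in> (if (0 \<in> D) = (1 \<in> D) then Suc ` replaceable_commas {i. Suc i \<in> D} (Suc n)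
     else insert 0 (Suc ` replaceable_commas {i. Suc i \<in> D} (Suc n)))"
    by (cases i) (simp_all add: image_iff)
qed

lemma shuffle_separators_Suc:
  "shuffle_separators D (Suc ` R) (Suc (Suc n)) = Comma # shuffle_separators {i. Suc i \<in> D} R (Suc n)"
  "shuffle_separators D (insert 0 (Suc ` R)) (Suc (Suc n)) =
     (if 0 \<in> D then Plus2 else Plus1) # shuffle_separators {i. Suc i \<in> D} R (Suc n)"
  by (auto simp: shuffle_separators_def upt_Suc_map comp_def simp del: upt_Suc)

lemma composition_add_up: "composition xs \<Longrightarrow> composition (add_up xs ss)"
  by (induction xs ss rule: add_up.induct) auto

text \<open>The first part of \<open>add_up (z # xs) ss\<close> starts with \<open>z\<close>, whatever \<open>z\<close> is, so increasing \<open>z\<close> by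
  \<open>x\<close> increases this part by \<open>x\<close> and leaves the others unchanged.\<close>

lemma add_up_first:
  "\<exists>h w. \<forall>x. add_up ((x + y) # xs) ss = (x + h) # w"
proof (induction xs arbitrary: y ss)
  case Nil
  then show ?case by auto
next
  case (Cons z xs)
  show ?case
  proof (cases ss)
    case (Cons s ss')
    then show ?thesis using Cons.IH[of "y + z" ss'] by (auto simp: add.assoc)
  qed auto
qed

context
  fixes q t :: "'k::field"
  assumes q_nonzero: "q \<noteq> 0"
begin

section \<open>The coefficients of \<open>\<D>\<^sub>\<alpha>\<close>\<close>

text \<open>\<open>block_coeff x \<alpha> \<phi> g\<close> extends a block that has the sum \<open>x\<close> so far by a beginning \<open>\<mu>\<close> of
  \<open>\<alpha> = \<mu> \<cdot> \<nu>\<close>, with a factor \<open>- t\<close> for each added part, so that its sum becomes \<open>g\<close>, and passes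
  the rest \<open>\<nu>\<close> to \<open>\<phi>\<close>.\<close>

primrec block_coeff :: "nat \<Rightarrow> nat list \<Rightarrow> (nat list \<Rightarrow> 'k) \<Rightarrow> nat \<Rightarrow> 'k" where
  "block_coeff x [] \<phi> g = (if x = g then \<phi> [] else 0)"
| "block_coeff x (a # \<alpha>) \<phi> g =
     (if x = g then \<phi> (a # \<alpha>) else 0) - t * block_coeff (x + a) \<alpha> \<phi> g"

text \<open>In a single variable, \<open>\<D>\<^sub>\<mu>(x) = q^(1-n) (-t)^(l-1) x^n\<close> if \<open>\<mu>\<close> has \<open>l > 0\<close> parts and sum \<open>n\<close>, and
  \<open>\<D>\<^sub>\<mu>(x) = 1\<close> if \<open>\<mu>\<close> is empty.  Summed over all cuts \<open>\<alpha> = \<mu> \<cdot> \<nu>\<close>, the coefficient of \<open>x^u\<close> here is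
  multiplied by \<open>\<phi> \<nu>\<close>.  For a composition \<open>\<alpha>\<close> only the empty \<open>\<mu>\<close> has sum \<open>0\<close>.\<close>

definition first_var :: "nat list \<Rightarrow> nat \<Rightarrow> (nat list \<Rightarrow> 'k) \<Rightarrow> 'k" where
  "first_var \<alpha> u \<phi> =
     (if u = 0 then \<phi> \<alpha>
      else case \<alpha> of [] \<Rightarrow> 0 | a # \<alpha>' \<Rightarrow> q powi (1 - int u) * block_coeff a \<alpha>' \<phi> u)"

text \<open>The coefficient of \<open>x\<^sub>0^u\<^sub>0 x\<^sub>1^u\<^sub>1 \<cdots>\<close> in \<open>\<D>\<^sub>\<alpha>\<close>, see \<open>coeff_D_qsym_xpow\<close>: each variable in turn
  takes a block of consecutive parts of \<open>\<alpha>\<close>.\<close>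

primrec D_coeff :: "nat list \<Rightarrow> nat list \<Rightarrow> 'k" where
  "D_coeff \<alpha> [] = (if \<alpha> = [] then 1 else 0)"
| "D_coeff \<alpha> (u # us) = first_var \<alpha> u (\<lambda>\<delta>. D_coeff \<delta> us)"

lemma block_coeff_less: "g < x \<Longrightarrow> block_coeff x \<alpha> \<phi> g = 0"
  by (induction \<alpha> arbitrary: x) auto

lemma block_coeff_shift:
  "x \<le> g \<Longrightarrow> block_coeff (x + b) \<alpha> \<phi> g = block_coeff b \<alpha> \<phi> (g - x)"
proof (induction \<alpha> arbitrary: b)
  case (Cons a \<alpha>)
  have eq: "x + b = g \<longleftrightarrow> b = g - x" using Cons.prems by auto
  show ?case using Cons.IH[of "b + a"] Cons.prems by (simp add: add.assoc[symmetric] eq)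
qed auto

lemma block_coeff_sum:
  "block_coeff x \<alpha> (\<lambda>\<delta>. \<Sum>i\<in>I. F i \<delta>) g = (\<Sum>i\<in>I. block_coeff x \<alpha> (F i) g)"
  by (induction \<alpha> arbitrary: x) (auto simp: sum_subtractf sum_distrib_left)

lemma block_coeff_scale:
  "block_coeff x \<alpha> (\<lambda>\<delta>. c * F \<delta>) g = c * block_coeff x \<alpha> F g"
  by (induction \<alpha> arbitrary: x) (auto simp: algebra_simps)

lemma first_var_sum:
  "first_var \<alpha> u (\<lambda>\<delta>. \<Sum>i\<in>I. F i \<delta>) = (\<Sum>i\<in>I. first_var \<alpha> u (F i))"
  by (auto simp: first_var_def block_coeff_sum sum_distrib_left split: list.split)

lemma first_var_scale: "first_var \<alpha> u (\<lambda>\<delta>. c * F \<delta>) = c * first_var \<alpha> u F"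
  by (auto simp: first_var_def block_coeff_scale split: list.split)

text \<open>In a composition the partial sums increase strictly, so at most one beginning completes a block to
  a given sum; with \<open>block_coeff_nonzeroE\<close> this determines \<open>block_coeff\<close>.\<close>

lemma block_coeff_append:
  "composition (\<mu> @ \<alpha>) \<Longrightarrow> block_coeff x (\<mu> @ \<alpha>) \<phi> (x + sum_list \<mu>) = (- t) ^ length \<mu> * \<phi> \<alpha>"
proof (induction \<mu> arbitrary: x)
  case Nil
  then show ?case by (cases \<alpha>) (auto simp: block_coeff_less)
next
  case (Cons a \<mu>)
  then show ?case using Cons.IH[of "x + a"] by (auto simp: algebra_simps)
qed

lemma block_coeff_nonzeroE:
  assumes "block_coeff x \<alpha> \<phi> g \<noteq> 0"
  obtains \<mu> \<nu> where "\<alpha> = \<mu> @ \<nu>" "g = x + sum_list \<mu>" "\<phi> \<nu> \<noteq> 0"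
  using assms
proof (induction \<alpha> arbitrary: x thesis)
  case Nil
  show ?case using Nil.prems(1)[of "[]" "[]"] Nil.prems(2) by (auto split: if_splits)
next
  case (Cons a \<alpha>)
  show ?case
  proof (cases "x = g \<and> \<phi> (a # \<alpha>) \<noteq> 0")
    case True
    then show ?thesis using Cons.prems(1)[of "[]" "a # \<alpha>"] by auto
  next
    case False
    then have "block_coeff (x + a) \<alpha> \<phi> g \<noteq> 0" using Cons.prems(2) by (auto split: if_splits)
    then obtain \<mu> \<nu> where "\<alpha> = \<mu> @ \<nu>" "g = x + a + sum_list \<mu>" "\<phi> \<nu> \<noteq> 0"
      using Cons.IH by blast
    then show ?thesis using Cons.prems(1)[of "a # \<mu>" \<nu>] by auto
  qed
qed

text \<open>If \<open>\<alpha>\<close> refines \<open>\<beta>\<close>, it does so in one way, and the factors \<open>q^(1-n) (-t)^(l-1)\<close> of the blocks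
  multiply to the coefficient in the definition of \<open>\<D>\<^sub>\<alpha>\<close>.\<close>

lemma D_coeff_refines:
  assumes "composition \<alpha>" "composition \<beta>"
  shows "D_coeff \<alpha> \<beta> =
    (if refines \<alpha> \<beta>
     then q powi (int (length \<beta>) - int (sum_list \<alpha>)) * (- t) ^ (length \<alpha> - length \<beta>) else 0)"
  using assms
proof (induction \<beta> arbitrary: \<alpha>)
  case Nil
  then show ?case by auto
next
  case (Cons g \<beta>)
  show ?case
  proof (cases "refines \<alpha> (g # \<beta>)")
    case True
    then obtain a \<mu> \<nu> where \<alpha>: "\<alpha> = a # \<mu> @ \<nu>" "g = a + sum_list \<mu>" "refines \<nu> \<beta>"
      by (auto simp: refines_Cons)
    have "D_coeff \<alpha> (g # \<beta>) = q powi (1 - int g) * ((- t) ^ length \<mu> * D_coeff \<nu> \<beta>)"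
      using Cons.prems \<alpha>
      by (simp add: first_var_def block_coeff_append)
    also have "\<dots> = q powi (1 - int g) * q powi (int (length \<beta>) - int (sum_list \<nu>))
        * ((- t) ^ length \<mu> * (- t) ^ (length \<nu> - length \<beta>))"
      using Cons.IH[of \<nu>] Cons.prems \<alpha> by (simp add: mult_ac)
    also have "\<dots> = q powi (int (length (g # \<beta>)) - int (sum_list \<alpha>)) * (- t) ^ (length \<alpha> - length (g # \<beta>))"
      using refines_length[OF \<alpha>(3)] \<alpha>
      by (simp add: power_add[symmetric] power_int_add[symmetric] q_nonzero algebra_simps)
    finally show ?thesis using True by simp
  next
    case False
    have "D_coeff \<alpha> (g # \<beta>) = 0"
    proof (rule ccontr)
      assume "D_coeff \<alpha> (g # \<beta>) \<noteq> 0"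
      then obtain a \<alpha>' where \<alpha>: "\<alpha> = a # \<alpha>'" "block_coeff a \<alpha>' (\<lambda>\<delta>. D_coeff \<delta> \<beta>) g \<noteq> 0"
        using Cons.prems by (auto simp: first_var_def split: list.splits)
      then obtain \<mu> \<nu> where \<mu>: "\<alpha>' = \<mu> @ \<nu>" "g = a + sum_list \<mu>" "D_coeff \<nu> \<beta> \<noteq> 0"
        using block_coeff_nonzeroE by blast
      then have "refines \<nu> \<beta>" using Cons.IH[of \<nu>] Cons.prems \<alpha> by (auto split: if_splits)
      then show False using False \<alpha> \<mu> by (auto simp: refines_Cons)
    qed
    then show ?thesis using False by simp
  qed
qed

lemma QM_coeff_D_qsym:
  assumes "composition \<alpha>" "composition \<beta>"
  shows "QM_coeff (D_qsym q t \<alpha>) \<beta> = D_coeff \<alpha> \<beta>"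
proof -
  let ?c = "\<lambda>\<beta>. q powi (int (length \<beta>) - int (sum_list \<alpha>)) * (- t) ^ (length \<alpha> - length \<beta>)"
  have "QM_coeff (D_qsym q t \<alpha>) \<beta> = (\<Sum>\<delta>\<in>{\<delta>. refines \<alpha> \<delta>}. if \<delta> = \<beta> then ?c \<beta> else 0)"
    unfolding D_qsym_def QM_coeff_sum
    using assms refines_composition
    by (intro sum.cong) (auto simp: QM_coeff_scale QM_coeff_QM)
  then show ?thesis by (simp add: finite_refines D_coeff_refines assms)
qed

lemma D_coeff_filter: "D_coeff \<alpha> (filter (\<lambda>u. u \<noteq> 0) us) = D_coeff \<alpha> us"
  by (induction us arbitrary: \<alpha>) (auto simp: first_var_def)

lemma coeff_D_qsym_xpow:
  assumes "composition \<alpha>" "length is = length us" "sorted_wrt (<) is"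
  shows "coeff_qsym (D_qsym q t \<alpha>) (xpow is us) = D_coeff \<alpha> us"
proof -
  have "composition (filter (\<lambda>u. u \<noteq> 0) us)" by (auto simp: composition_def)
  then show ?thesis
    using assms by (simp only: coeff_qsym_xpow QM_coeff_D_qsym D_coeff_filter)
qed

lemma D_coeff_nonzero_sum_list: 
  "composition \<alpha> \<Longrightarrow> composition \<beta> \<Longrightarrow> D_coeff \<alpha> \<beta> \<noteq> 0 \<Longrightarrow> sum_list \<beta> = sum_list \<alpha>"
  using refines_sum_list by (auto simp: D_coeff_refines split: if_splits)

lemma QM_support_D_qsym:
  assumes "composition \<alpha>" "sum_list \<alpha> \<le> N"
  shows "QM_support (D_qsym q t \<alpha>) \<subseteq> compositions_upto N"
  using assms D_coeff_nonzero_sum_list[OF assms(1)]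
  by (auto simp: QM_support_def QM_coeff_D_qsym compositions_upto_def)

lemma D_qsym_expansion:
  assumes "composition \<alpha>" "sum_list \<alpha> \<le> N"
  shows "D_qsym q t \<alpha> = (\<Sum>\<delta>\<in>compositions_upto N. qsym_scale (D_coeff \<alpha> \<delta>) (QM \<delta>))"
proof -
  interpret Q: vector_space "qsym_scale :: 'k \<Rightarrow> 'k qsym \<Rightarrow> 'k qsym"
    by (rule vector_space_qsym_scale)
  have "D_qsym q t \<alpha> = (\<Sum>\<delta>\<in>compositions_upto N. qsym_scale (QM_coeff (D_qsym q t \<alpha>) \<delta>) (QM \<delta>))"
    by (subst qsym_expansion, rule sum.mono_neutral_left)
      (use QM_support_D_qsym[OF assms] finite_compositions_upto in \<open>auto simp: QM_support_def compositions_upto_def\<close>)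
  also have "\<dots> = (\<Sum>\<delta>\<in>compositions_upto N. qsym_scale (D_coeff \<alpha> \<delta>) (QM \<delta>))"
    using assms by (intro sum.cong) (auto simp: compositions_upto_def QM_coeff_D_qsym)
  finally show ?thesis .
qed

section \<open>The coproduct\<close>

text \<open>Filling the first variable commutes with cutting: the block for this variable is taken from the
  left piece.\<close>

lemma block_coeff_splits:
  "block_coeff x \<gamma> (\<lambda>\<delta>. \<Sum>(\<alpha>, \<beta>)\<in>splits \<delta>. \<phi> \<alpha> * \<psi> \<beta>) g =
   (\<Sum>(\<alpha>, \<beta>)\<in>splits \<gamma>. block_coeff x \<alpha> \<phi> g * \<psi> \<beta>)"
proof (induction \<gamma> arbitrary: x)
  case (Cons c \<gamma>)
  have "(\<Sum>(\<alpha>, \<beta>)\<in>splits \<gamma>. block_coeff x (c # \<alpha>) \<phi> g * \<psi> \<beta>) =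
      (if x = g then \<Sum>(\<alpha>, \<beta>)\<in>splits \<gamma>. \<phi> (c # \<alpha>) * \<psi> \<beta> else 0)
      - t * (\<Sum>(\<alpha>, \<beta>)\<in>splits \<gamma>. block_coeff (x + c) \<alpha> \<phi> g * \<psi> \<beta>)"
    by (simp add: case_prod_unfold left_diff_distrib sum_subtractf sum_distrib_left mult.assoc)
  then show ?case
    by (simp only: sum_splits_Cons block_coeff.simps Cons.IH) (simp add: distrib_right)
qed auto

lemma first_var_splits:
  "first_var \<gamma> u (\<lambda>\<delta>. \<Sum>(\<alpha>, \<beta>)\<in>splits \<delta>. \<phi> \<alpha> * \<psi> \<beta>) =
   (\<Sum>(\<alpha>, \<beta>)\<in>splits \<gamma>. first_var \<alpha> u \<phi> * \<psi> \<beta>)"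
proof (cases \<gamma>)
  case (Cons c \<gamma>')
  then show ?thesis
    using block_coeff_splits[of c \<gamma>' \<phi> \<psi> u]
    by (simp add: first_var_def sum_splits_Cons)
      (simp add: sum_distrib_left case_prod_unfold mult.assoc)
qed (auto simp: first_var_def)

text \<open>The parts of \<open>\<gamma>\<close> used by the variables of \<open>us\<close> precede those used by the variables of \<open>vs\<close>; the
  cut is between them.  For compositions \<open>us\<close> and \<open>vs\<close> this compares the coefficients of
  \<open>M\<^bsub>us\<^esub> \<otimes> M\<^bsub>vs\<^esub>\<close> in the coproduct formula.\<close>

lemma D_coeff_append:
  "D_coeff \<gamma> (us @ vs) = (\<Sum>(\<alpha>, \<beta>)\<in>splits \<gamma>. D_coeff \<alpha> us * D_coeff \<beta> vs)"
proof (induction us arbitrary: \<gamma>)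
  case Nil
  show ?case
  proof (cases \<gamma>)
    case (Cons c \<gamma>')
    then show ?thesis by (simp add: sum_splits_Cons del: D_coeff.simps(2))
  qed simp
next
  case (Cons u us)
  show ?case by (simp add: Cons.IH first_var_splits)
qed

theorem coproduct_D_qsym:
  assumes "composition \<gamma>"
  shows "qsym_coproduct (D_qsym q t \<gamma>) =
    (\<Sum>(\<alpha>, \<beta>)\<in>{(\<alpha>, \<beta>). \<alpha> @ \<beta> = \<gamma>}. D_qsym q t \<alpha> \<otimes> D_qsym q t \<beta>)"
proof -
  interpret T: vector_space "tensor_scale :: 'k \<Rightarrow> 'k qsym_tensor \<Rightarrow> 'k qsym_tensor"
    by (rule vector_space_tensor_scale)
  define C where "C = compositions_upto (sum_list \<gamma>)"
  have C: "finite C" by (simp add: C_def finite_compositions_upto)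
  let ?T = "\<lambda>\<delta> \<epsilon>. tensor_scale (D_coeff \<gamma> (\<delta> @ \<epsilon>)) (QM \<delta> \<otimes> QM \<epsilon>)"
  \<comment> \<open>In the basis of the \<open>QM \<delta> \<otimes> QM \<epsilon>\<close> both sides have the coefficient \<open>D_coeff \<gamma> (\<delta> @ \<epsilon>)\<close>.\<close>
  have "qsym_coproduct (D_qsym q t \<gamma>) = (\<Sum>\<zeta>\<in>C. \<Sum>(\<delta>, \<epsilon>)\<in>splits \<zeta>. ?T \<delta> \<epsilon>)"
    unfolding C_def
    by (subst qsym_coproduct_superset[OF finite_compositions_upto QM_support_D_qsym[OF assms order_refl]])
      (auto simp: compositions_upto_def QM_coeff_D_qsym assms splits_def T.scale_sum_right intro!: sum.cong)
  also have "\<dots> = (\<Sum>(\<zeta>, p)\<in>(SIGMA \<zeta>:C. splits \<zeta>). case p of (\<delta>, \<epsilon>) \<Rightarrow> ?T \<delta> \<epsilon>)"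
    using C by (intro sum.Sigma) auto
  also have "\<dots> = (\<Sum>(\<delta>, \<epsilon>)\<in>{(\<delta>, \<epsilon>). \<delta> @ \<epsilon> \<in> C}. ?T \<delta> \<epsilon>)"
    by (rule sum.reindex_bij_witness[where i = "\<lambda>(\<delta>, \<epsilon>). (\<delta> @ \<epsilon>, (\<delta>, \<epsilon>))" and j = snd])
      (auto simp: splits_def)
  also have "\<dots> = (\<Sum>(\<delta>, \<epsilon>)\<in>C \<times> C. ?T \<delta> \<epsilon>)"
  proof (rule sum.mono_neutral_left)
    show "{(\<delta>, \<epsilon>). \<delta> @ \<epsilon> \<in> C} \<subseteq> C \<times> C" by (auto simp: C_def compositions_upto_def)
    show "\<forall>i\<in>C \<times> C - {(\<delta>, \<epsilon>). \<delta> @ \<epsilon> \<in> C}. (case i of (\<delta>, \<epsilon>) \<Rightarrow> ?T \<delta> \<epsilon>) = 0"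
    proof
      fix p assume "p \<in> C \<times> C - {(\<delta>, \<epsilon>). \<delta> @ \<epsilon> \<in> C}"
      then obtain \<delta> \<epsilon> where p: "p = (\<delta>, \<epsilon>)" "\<delta> \<in> C" "\<epsilon> \<in> C" "\<delta> @ \<epsilon> \<notin> C" by auto
      then have "D_coeff \<gamma> (\<delta> @ \<epsilon>) = 0"
        using D_coeff_nonzero_sum_list[OF assms, of "\<delta> @ \<epsilon>"] by (auto simp: C_def compositions_upto_def)
      then show "(case p of (\<delta>, \<epsilon>) \<Rightarrow> ?T \<delta> \<epsilon>) = 0" using p by simp
    qed
  qed (use C in auto)
  also have "\<dots> = (\<Sum>(\<delta>, \<epsilon>)\<in>C \<times> C. \<Sum>(\<alpha>, \<beta>)\<in>splits \<gamma>.
      tensor_scale (D_coeff \<alpha> \<delta> * D_coeff \<beta> \<epsilon>) (QM \<delta> \<otimes> QM \<epsilon>))"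
    by (simp add: D_coeff_append T.scale_sum_left case_prod_unfold)
  also have "\<dots> = (\<Sum>(\<alpha>, \<beta>)\<in>splits \<gamma>. \<Sum>(\<delta>, \<epsilon>)\<in>C \<times> C.
      tensor_scale (D_coeff \<alpha> \<delta> * D_coeff \<beta> \<epsilon>) (QM \<delta> \<otimes> QM \<epsilon>))"
    unfolding case_prod_unfold by (rule sum.swap)
  also have "\<dots> = (\<Sum>(\<alpha>, \<beta>)\<in>splits \<gamma>. D_qsym q t \<alpha> \<otimes> D_qsym q t \<beta>)"
  proof (rule sum.cong[OF refl], clarify)
    fix \<alpha> \<beta> assume "(\<alpha>, \<beta>) \<in> splits \<gamma>"
    then have ab: "composition \<alpha>" "sum_list \<alpha> \<le> sum_list \<gamma>" "composition \<beta>" "sum_list \<beta> \<le> sum_list \<gamma>"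
      using assms by (auto simp: splits_def)
    have "D_qsym q t \<alpha> \<otimes> D_qsym q t \<beta> = (\<Sum>\<delta>\<in>C. \<Sum>\<epsilon>\<in>C.
        qsym_scale (D_coeff \<alpha> \<delta>) (QM \<delta>) \<otimes> qsym_scale (D_coeff \<beta> \<epsilon>) (QM \<epsilon>))"
      unfolding D_qsym_expansion[OF ab(1,2)] D_qsym_expansion[OF ab(3,4)] C_def[symmetric]
        tensor_sum_left tensor_sum_right
      by (rule sum.swap)
    then show "(\<Sum>(\<delta>, \<epsilon>)\<in>C \<times> C. tensor_scale (D_coeff \<alpha> \<delta> * D_coeff \<beta> \<epsilon>) (QM \<delta> \<otimes> QM \<epsilon>)) =
        D_qsym q t \<alpha> \<otimes> D_qsym q t \<beta>"
      by (simp add: tensor_scale_left tensor_scale_right sum.cartesian_product[symmetric] mult.commute)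
  qed
  finally show ?thesis by (simp add: splits_def)
qed

section \<open>Summing over the separators of a shuffle\<close>

text \<open>The coefficient at \<open>gs\<close> when a finished block of sum \<open>x\<close> fills the first variable and \<open>f\<close> gives the
  coefficients in the later ones.\<close>

definition leading_part :: "nat \<Rightarrow> (nat list \<Rightarrow> 'k) \<Rightarrow> nat list \<Rightarrow> 'k" where
  "leading_part x f gs = (case gs of [] \<Rightarrow> 0 | g # gs' \<Rightarrow> if x = g then q powi (1 - int g) * f gs' else 0)"

lemma leading_part_simps [simp]:
  "leading_part x f [] = 0"
  "leading_part x f (g # gs) = (if x = g then q powi (1 - int g) * f gs else 0)"
  by (simp_all add: leading_part_def)

lemma D_coeff_empty: "composition gs \<Longrightarrow> D_coeff [] gs = (if gs = [] then 1 else 0)"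
  by (cases gs) (auto simp: first_var_def)

lemma D_coeff_single: "composition gs \<Longrightarrow> D_coeff [x] gs = leading_part x (D_coeff []) gs"
  by (cases gs) (auto simp: first_var_def)

text \<open>The block that starts with \<open>x\<close> ends there or also contains \<open>y\<close>.\<close>

lemma D_coeff_Cons_Cons:
  "composition gs \<Longrightarrow>
    D_coeff (x # y # \<alpha>) gs = leading_part x (D_coeff (y # \<alpha>)) gs - t * D_coeff ((x + y) # \<alpha>) gs"
  by (cases gs) (auto simp: first_var_def algebra_simps)

text \<open>The weight with which two neighbouring letters end up in the same block, with marks \<open>True\<close> for
  parts of \<open>\<beta>\<close>.  A comma that stays contributes \<open>- t\<close> by \<open>D_coeff_Cons_Cons\<close>; to this a possible \<open>+\<^sub>1\<close> adds
  \<open>q + t\<close> and a possible \<open>+\<^sub>2\<close> adds \<open>t\<close>.\<close>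

definition merge_weight :: "bool \<Rightarrow> bool \<Rightarrow> 'k" where
  "merge_weight s s' = (if s = s' then - t else if s then 0 else q)"

text \<open>The sum over all ways to merge neighbouring letters into blocks.  A block that is still open is
  represented by its sum and the mark of its last letter.\<close>

fun word_coeff :: "(bool \<times> nat) list \<Rightarrow> nat list \<Rightarrow> 'k" where
  "word_coeff [] gs = (if gs = [] then 1 else 0)"
| "word_coeff [(s, x)] gs = leading_part x (word_coeff []) gs"
| "word_coeff ((s, x) # (s', y) # w) gs =
     leading_part x (word_coeff ((s', y) # w)) gs + merge_weight s s' * word_coeff ((s', x + y) # w) gs"

definition separator_weight :: "separator list \<Rightarrow> 'k" where
  "separator_weight ss = (q + t) ^ count_list ss Plus1 * t ^ count_list ss Plus2"

text \<open>A letter and its right neighbour are separated if the comma between them stays and is not merged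
  in \<open>\<D>\<close>.  They are merged either in \<open>\<D>\<close> or by a replaced comma, and both ways lead to the same
  remaining word; adding their weights gives \<open>merge_weight\<close>.\<close>

lemma sum_separators_Cons:
  "composition gs \<Longrightarrow>
   (\<Sum>R\<in>Pow (replaceable_commas D (Suc (length xs))).
      separator_weight (shuffle_separators D R (Suc (length xs)))
      * D_coeff (add_up (x # xs) (shuffle_separators D R (Suc (length xs)))) gs) =
   word_coeff (label D (x # xs)) gs"
proof (induction xs arbitrary: x D gs)
  case Nil
  have "replaceable_commas D (Suc 0) = {}" by (auto simp: replaceable_commas_def)
  then show ?case
    using Nil.prems
    by (cases gs)
      (auto simp: shuffle_separators_def separator_weight_def label_Cons D_coeff_single D_coeff_empty
       simp del: D_coeff.simps)
next
  case (Cons y xs)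
  let ?D = "{i. Suc i \<in> D}" and ?n = "Suc (length xs)"
  let ?P = "Pow (replaceable_commas ?D ?n)"
  define ss where "ss R = shuffle_separators ?D R ?n" for R
  have IH: "(\<Sum>R\<in>?P. separator_weight (ss R) * D_coeff (add_up (z # xs) (ss R)) hs) =
      word_coeff (label ?D (z # xs)) hs" if "composition hs" for z hs
    unfolding ss_def using that by (rule Cons.IH)
  have "D_coeff (x # add_up (y # xs) (ss R)) gs =
      leading_part x (D_coeff (add_up (y # xs) (ss R))) gs - t * D_coeff (add_up ((x + y) # xs) (ss R)) gs" for R
  proof -
    obtain h w where hw: "add_up ((z + y) # xs) (ss R) = (z + h) # w" for z
      using add_up_first by metis
    show ?thesis using hw[of 0] hw[of x] Cons.prems by (simp add: D_coeff_Cons_Cons del: D_coeff.simps)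
  qed
  moreover have "(\<Sum>R\<in>?P. separator_weight (ss R) * leading_part x (D_coeff (add_up (y # xs) (ss R))) gs) =
      leading_part x (word_coeff (label ?D (y # xs))) gs"
  proof (cases gs)
    case (Cons g gs')
    then have "composition gs'" using Cons.prems by simp
    from IH[OF this, of y, symmetric] show ?thesis
      by (simp add: Cons sum_distrib_left mult.left_commute del: D_coeff.simps)
  qed simp
  ultimately have comma: "(\<Sum>R\<in>?P. separator_weight (ss R) * D_coeff (x # add_up (y # xs) (ss R)) gs) =
      leading_part x (word_coeff (label ?D (y # xs))) gs - t * word_coeff (label ?D ((x + y) # xs)) gs"
    using IH[OF Cons.prems, of "x + y"]
    by (simp add: right_diff_distrib sum_subtractf mult.left_commute[of _ t] sum_distrib_left[symmetric] del: D_coeff.simps)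
  have wt: "separator_weight (Comma # s) = separator_weight s"
    "separator_weight (Plus1 # s) = (q + t) * separator_weight s"
    "separator_weight (Plus2 # s) = t * separator_weight s" for s
    by (simp_all add: separator_weight_def mult_ac)
  have merged: "(\<Sum>R\<in>?P. c * separator_weight (ss R) * D_coeff (add_up ((x + y) # xs) (ss R)) gs) =
      c * word_coeff (label ?D ((x + y) # xs)) gs" for c
    unfolding IH[OF Cons.prems, symmetric] by (simp only: sum_distrib_left mult.assoc)
  have word: "word_coeff (label D (x # y # xs)) gs = leading_part x (word_coeff (label ?D (y # xs))) gs
      + merge_weight (0 \<in> D) (1 \<in> D) * word_coeff (label ?D ((x + y) # xs)) gs"
    by (simp add: label_Cons)
  have len: "length (y # xs) = ?n" by simp
  have kept: "add_up (x # y # xs) (Comma # s) = x # add_up (y # xs) s"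
    "add_up (x # y # xs) (Plus1 # s) = add_up ((x + y) # xs) s"
    "add_up (x # y # xs) (Plus2 # s) = add_up ((x + y) # xs) s" for s by simp_all
  consider "(0 \<in> D) = (1 \<in> D)" | "0 \<in> D" "1 \<notin> D" | "0 \<notin> D" "1 \<in> D" by blast
  then show ?case
  proof cases
    case 1
    have "merge_weight (0 \<in> D) (1 \<in> D) = - t" using 1 by (simp add: merge_weight_def)
    then show ?thesis
      unfolding len replaceable_commas_Suc if_P[OF 1]
      by (simp only: sum_Pow_Suc shuffle_separators_Suc ss_def[symmetric] wt kept comma word) simp
  next
    case 2
    then show ?thesis
      by (simp only: len replaceable_commas_Suc if_True if_False simp_thms
          sum_Pow_insert_0_Suc[OF finite_replaceable_commas] shuffle_separators_Suc
          ss_def[symmetric] wt kept comma merged word merge_weight_def) simp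
  next
    case 3
    then show ?thesis
      by (simp only: len replaceable_commas_Suc if_True if_False simp_thms
          sum_Pow_insert_0_Suc[OF finite_replaceable_commas] shuffle_separators_Suc
          ss_def[symmetric] wt kept comma merged word merge_weight_def) (simp add: distrib_right)
  qed
qed

lemma sum_separators:
  assumes "composition gs" "length xs = n"
  shows "(\<Sum>R\<in>Pow (replaceable_commas D n).
      separator_weight (shuffle_separators D R n) * D_coeff (add_up xs (shuffle_separators D R n)) gs) =
   word_coeff (label D xs) gs"
proof (cases xs)
  case Nil
  have "replaceable_commas D 0 = {}" by (auto simp: replaceable_commas_def)
  then show ?thesis using Nil assms
    by (auto simp: separator_weight_def shuffle_separators_def D_coeff_empty simp del: D_coeff.simps)
next
  case (Cons x xs')
  then show ?thesis using sum_separators_Cons[OF assms(1), of D xs' x] assms(2) by simp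
qed

lemma word_coeff_Cons_Nil: "word_coeff (p # w) [] = 0"
  by (induction "p # w" "[] :: nat list" arbitrary: p w rule: word_coeff.induct) auto

section \<open>The product\<close>

definition product_coeff :: "nat list \<Rightarrow> nat list \<Rightarrow> nat list \<Rightarrow> 'k" where
  "product_coeff \<alpha> \<beta> gs = (\<Sum>(us, vs)\<in>sum_pairs gs. D_coeff \<alpha> us * D_coeff \<beta> vs)"

lemma product_coeff_Nil: "product_coeff \<alpha> \<beta> [] = (if \<alpha> = [] \<and> \<beta> = [] then 1 else 0)"
  by (simp add: product_coeff_def)

lemma product_coeff_Cons:
  "product_coeff \<alpha> \<beta> (g # gs) =
    (\<Sum>u\<le>g. first_var \<alpha> u (\<lambda>\<delta>. first_var \<beta> (g - u) (\<lambda>\<epsilon>. product_coeff \<delta> \<epsilon> gs)))"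
proof -
  have "first_var \<alpha> u (\<lambda>\<delta>. first_var \<beta> v (\<lambda>\<epsilon>. product_coeff \<delta> \<epsilon> gs)) =
      (\<Sum>(us, vs)\<in>sum_pairs gs. D_coeff \<alpha> (u # us) * D_coeff \<beta> (v # vs))" for u v
  proof -
    have "first_var \<beta> v (\<lambda>\<epsilon>. product_coeff \<delta> \<epsilon> gs) =
        (\<Sum>p\<in>sum_pairs gs. D_coeff \<beta> (v # snd p) * D_coeff \<delta> (fst p))" for \<delta>
      unfolding product_coeff_def case_prod_unfold
      by (simp add: first_var_sum first_var_scale) (simp add: mult.commute)
    then show ?thesis
      by (simp add: first_var_sum first_var_scale case_prod_unfold) (simp add: mult.commute)
  qed
  then show ?thesis
    by (simp add: product_coeff_def[of _ _ "g # gs"] sum_sum_pairs_Cons del: D_coeff.simps)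
qed

lemma QM_coeff_product:
  assumes "composition \<alpha>" "composition \<beta>"
  shows "QM_coeff (D_qsym q t \<alpha> * D_qsym q t \<beta>) gs = product_coeff \<alpha> \<beta> gs"
proof -
  have "QM_coeff (D_qsym q t \<alpha> * D_qsym q t \<beta>) gs =
      (\<Sum>(us, vs)\<in>sum_pairs gs. coeff_qsym (D_qsym q t \<alpha>) (xpow [0..<length gs] us)
        * coeff_qsym (D_qsym q t \<beta>) (xpow [0..<length gs] vs))"
    unfolding QM_coeff_def times_qsym.rep_eq sum_pairs_def by (rule ps_mult_xpow) simp_all
  also have "\<dots> = product_coeff \<alpha> \<beta> gs"
    unfolding product_coeff_def
  proof (rule sum.cong[OF refl], clarify)
    fix us vs assume "(us, vs) \<in> sum_pairs gs"
    then have "length us = length gs" "length vs = length gs"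
      unfolding sum_pairs_def mem_Collect_eq prod.case by blast+
    then show "coeff_qsym (D_qsym q t \<alpha>) (xpow [0..<length gs] us)
        * coeff_qsym (D_qsym q t \<beta>) (xpow [0..<length gs] vs) = D_coeff \<alpha> us * D_coeff \<beta> vs"
      by (simp add: coeff_D_qsym_xpow assms)
  qed
  finally show ?thesis .
qed

text \<open>By \<open>sum_separators\<close>, the coefficient of the sum over all two-way overlapping shuffles.\<close>

definition total_coeff :: "nat list \<Rightarrow> nat list \<Rightarrow> nat list \<Rightarrow> 'k" where
  "total_coeff \<alpha> \<beta> gs = shuffle_sum \<alpha> \<beta> (\<lambda>w. word_coeff w gs)"

text \<open>The same sum while a first block with sum \<open>x\<close>, whose last letter has the mark \<open>s\<close>, is still open.\<close>

definition open_block_coeff :: "bool \<Rightarrow> nat \<Rightarrow> nat list \<Rightarrow> nat list \<Rightarrow> nat list \<Rightarrow> 'k" where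
  "open_block_coeff s x \<alpha> \<beta> gs = shuffle_sum \<alpha> \<beta> (\<lambda>w. word_coeff ((s, x) # w) gs)"

lemma total_coeff_first:
  "total_coeff \<alpha> \<beta> gs =
    (case \<alpha> of [] \<Rightarrow> if \<beta> = [] \<and> gs = [] then 1 else 0 | a # \<alpha>' \<Rightarrow> open_block_coeff False a \<alpha>' \<beta> gs) +
    (case \<beta> of [] \<Rightarrow> 0 | b # \<beta>' \<Rightarrow> open_block_coeff True b \<alpha> \<beta>' gs)"
  unfolding total_coeff_def open_block_coeff_def
  by (subst shuffle_sum_first) (auto split: list.split)

lemma open_block_coeff_next:
  "open_block_coeff s x \<alpha> \<beta> gs = leading_part x (total_coeff \<alpha> \<beta>) gs +
    (case \<alpha> of [] \<Rightarrow> 0 | a # \<alpha>' \<Rightarrow> merge_weight s False * open_block_coeff False (x + a) \<alpha>' \<beta> gs) +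
    (case \<beta> of [] \<Rightarrow> 0 | b # \<beta>' \<Rightarrow> merge_weight s True * open_block_coeff True (x + b) \<alpha> \<beta>' gs)"
proof -
  define M where "M w = (case w of [] \<Rightarrow> 0
    | (s', y) # w' \<Rightarrow> merge_weight s s' * word_coeff ((s', x + y) # w') gs)" for w
  have "word_coeff ((s, x) # w) gs = leading_part x (word_coeff w) gs + M w" for w
    by (cases w) (auto simp: M_def)
  then have "open_block_coeff s x \<alpha> \<beta> gs =
      shuffle_sum \<alpha> \<beta> (\<lambda>w. leading_part x (word_coeff w) gs) + shuffle_sum \<alpha> \<beta> M"
    by (simp add: open_block_coeff_def shuffle_sum_add)
  moreover have "shuffle_sum \<alpha> \<beta> (\<lambda>w. leading_part x (word_coeff w) gs) = leading_part x (total_coeff \<alpha> \<beta>) gs"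
    by (cases gs) (auto simp: total_coeff_def shuffle_sum_scale shuffle_sum_0)
  moreover have "shuffle_sum \<alpha> \<beta> M =
    (case \<alpha> of [] \<Rightarrow> 0 | a # \<alpha>' \<Rightarrow> merge_weight s False * open_block_coeff False (x + a) \<alpha>' \<beta> gs) +
    (case \<beta> of [] \<Rightarrow> 0 | b # \<beta>' \<Rightarrow> merge_weight s True * open_block_coeff True (x + b) \<alpha> \<beta>' gs)"
    by (subst shuffle_sum_first)
      (auto simp: M_def open_block_coeff_def shuffle_sum_scale split: list.split)
  ultimately show ?thesis by (simp add: add.assoc)
qed

text \<open>A block with nonzero weight contains no part of \<open>\<alpha>\<close> after a part of \<open>\<beta>\<close>.  It is therefore a run of
  \<open>i\<close> parts of \<open>\<alpha>\<close> followed by a run of \<open>j\<close> parts of \<open>\<beta>\<close>.  For \<open>i, j > 0\<close> and total \<open>n\<close> its weight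
  \<open>q^(1-n) \<cdot> (-t)^(i-1) \<cdot> q \<cdot> (-t)^(j-1)\<close> is the product of the weights that the two runs have as blocks
  of \<open>\<alpha>\<close> and of \<open>\<beta>\<close> that fill the same variable; for \<open>i = 0\<close> or \<open>j = 0\<close> there is only one run.  Hence
  the merged shuffles correspond to pairs of distributions of \<open>\<alpha>\<close> and \<open>\<beta>\<close> on the variables.\<close>

lemma total_coeff_eq_product_coeff:
  "composition \<alpha> \<Longrightarrow> composition \<beta> \<Longrightarrow> composition gs \<Longrightarrow> total_coeff \<alpha> \<beta> gs = product_coeff \<alpha> \<beta> gs"
proof (induction gs arbitrary: \<alpha> \<beta>)
  case Nil
  have "open_block_coeff s x \<alpha>' \<beta>' [] = 0" for s x \<alpha>' \<beta>'
    by (simp add: open_block_coeff_def word_coeff_Cons_Nil shuffle_sum_0)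
  then show ?case by (auto simp: total_coeff_first[of \<alpha>] product_coeff_Nil split: list.split)
next
  case (Cons g gs)
  have g: "0 < g" and gs: "composition gs" using Cons.prems by auto
  have IH: "total_coeff \<delta> \<epsilon> gs = product_coeff \<delta> \<epsilon> gs" if "composition \<delta>" "composition \<epsilon>" for \<delta> \<epsilon>
    using Cons.IH that gs by blast
  \<comment> \<open>Weight \<open>0\<close> for a part of \<open>\<alpha>\<close> after a part of \<open>\<beta>\<close>: an open block that ends in a part
    of \<open>\<beta>\<close> can only absorb further parts of \<open>\<beta>\<close>.\<close>
  have beta_block: "open_block_coeff True x \<delta> \<epsilon> (g # gs) =
      q powi (1 - int g) * block_coeff x \<epsilon> (\<lambda>\<epsilon>'. product_coeff \<delta> \<epsilon>' gs) g"
    if "composition \<delta>" "composition \<epsilon>" for x \<delta> \<epsilon>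
    using that(2)
  proof (induction \<epsilon> arbitrary: x)
    case Nil
    then show ?case using that
      by (subst open_block_coeff_next) (auto simp: IH merge_weight_def split: list.split)
  next
    case (Cons b \<epsilon>)
    then show ?case using that
      by (subst open_block_coeff_next) (auto simp: IH merge_weight_def algebra_simps split: list.split)
  qed
  \<comment> \<open>The factor of a block of \<open>\<epsilon>\<close> (possibly empty) of sum \<open>v\<close>, times what remains for the later variables.\<close>
  define S where "S v \<delta> \<epsilon> = first_var \<epsilon> v (\<lambda>\<epsilon>'. product_coeff \<delta> \<epsilon>' gs)" for v \<delta> \<epsilon>
  \<comment> \<open>When the run of parts of \<open>\<alpha>\<close> in a block is over, the block ends or a run of parts of \<open>\<beta>\<close>
    starts; the weight \<open>q\<close> of that step is the quotient of the powers of \<open>q\<close> in the two separate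
    blocks and in the merged one.\<close>
  have close_block: "(\<Sum>u\<le>g. q powi (1 - int u) * (if x = u then S (g - u) \<delta> \<epsilon> else 0)) =
      leading_part x (total_coeff \<delta> \<epsilon>) (g # gs) +
      (case \<epsilon> of [] \<Rightarrow> 0 | b # \<epsilon>' \<Rightarrow> q * open_block_coeff True (x + b) \<delta> \<epsilon>' (g # gs))"
    if "composition \<delta>" "composition \<epsilon>" for x \<delta> \<epsilon>
  proof -
    have "(\<Sum>u\<le>g. q powi (1 - int u) * (if x = u then S (g - u) \<delta> \<epsilon> else 0)) =
        (\<Sum>u\<le>g. if x = u then q powi (1 - int u) * S (g - u) \<delta> \<epsilon> else 0)"
      by (rule sum.cong) auto
    also have "\<dots> = (if x \<le> g then q powi (1 - int x) * S (g - x) \<delta> \<epsilon> else 0)"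
      by (subst sum.delta') auto
    also have "\<dots> = leading_part x (total_coeff \<delta> \<epsilon>) (g # gs) +
      (case \<epsilon> of [] \<Rightarrow> 0 | b # \<epsilon>' \<Rightarrow> q * open_block_coeff True (x + b) \<delta> \<epsilon>' (g # gs))"
    proof (cases "x < g")
      case True
      have "q powi (1 - int x) * q powi (1 - int (g - x)) = q * q powi (1 - int g)"
        using True q_nonzero by (simp add: power_int_add[symmetric] power_int_add_1'[symmetric] of_nat_diff algebra_simps)
      then show ?thesis
        using True that
        by (cases \<epsilon>) (auto simp: S_def first_var_def beta_block block_coeff_shift mult.assoc[symmetric])
    next
      case False
      then show ?thesis using that
        by (cases \<epsilon>) (auto simp: S_def first_var_def beta_block block_coeff_less IH)
    qed
    finally show ?thesis .
  qed
  have mixed_block: "open_block_coeff False x \<delta> \<epsilon> (g # gs) =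
      (\<Sum>u\<le>g. q powi (1 - int u) * block_coeff x \<delta> (\<lambda>\<delta>'. S (g - u) \<delta>' \<epsilon>) u)"
    if "composition \<delta>" "composition \<epsilon>" for x \<delta> \<epsilon>
    using that(1)
  proof (induction \<delta> arbitrary: x)
    case Nil
    show ?case using close_block[OF Nil that(2), of x]
      by (subst open_block_coeff_next) (auto simp: merge_weight_def split: list.split)
  next
    case (Cons a \<delta>)
    have "open_block_coeff False x (a # \<delta>) \<epsilon> (g # gs) =
        (\<Sum>u\<le>g. q powi (1 - int u) * (if x = u then S (g - u) (a # \<delta>) \<epsilon> else 0))
        - t * open_block_coeff False (x + a) \<delta> \<epsilon> (g # gs)"
      unfolding close_block[OF Cons.prems that(2)]
      by (subst open_block_coeff_next) (auto simp: merge_weight_def split: list.split)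
    then show ?case
      using Cons.IH[of "x + a"] Cons.prems
      by (simp add: sum_distrib_left sum_subtractf[symmetric] right_diff_distrib mult.left_commute)
  qed
  \<comment> \<open>Exponent \<open>0\<close> from the first factor means that the first block starts with a part of \<open>\<beta>\<close>.\<close>
  have "product_coeff \<alpha> \<beta> (g # gs) = (\<Sum>u\<in>insert 0 {0<..g}. first_var \<alpha> u (\<lambda>\<delta>. S (g - u) \<delta> \<beta>))"
    unfolding product_coeff_Cons S_def by (rule sum.cong) auto
  also have "\<dots> = S g \<alpha> \<beta> + (\<Sum>u\<in>{0<..g}. first_var \<alpha> u (\<lambda>\<delta>. S (g - u) \<delta> \<beta>))"
    by (subst sum.insert) (auto simp: first_var_def)
  finally have product: "product_coeff \<alpha> \<beta> (g # gs) =
      S g \<alpha> \<beta> + (\<Sum>u\<in>{0<..g}. first_var \<alpha> u (\<lambda>\<delta>. S (g - u) \<delta> \<beta>))" .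
  have only_\<beta>: "S g \<alpha> \<beta> = (case \<beta> of [] \<Rightarrow> 0 | b # \<beta>' \<Rightarrow> open_block_coeff True b \<alpha> \<beta>' (g # gs))"
    using g Cons.prems by (auto simp: S_def first_var_def beta_block split: list.split)
  have some_\<alpha>: "(\<Sum>u\<in>{0<..g}. first_var \<alpha> u (\<lambda>\<delta>. S (g - u) \<delta> \<beta>)) =
      (case \<alpha> of [] \<Rightarrow> 0 | a # \<alpha>' \<Rightarrow> open_block_coeff False a \<alpha>' \<beta> (g # gs))"
  proof (cases \<alpha>)
    case Nil
    then show ?thesis by (auto simp: first_var_def intro!: sum.neutral)
  next
    case (Cons a \<alpha>')
    then have a: "0 < a" "composition \<alpha>'" using \<open>composition \<alpha>\<close> by auto
    have "(\<Sum>u\<in>{0<..g}. first_var \<alpha> u (\<lambda>\<delta>. S (g - u) \<delta> \<beta>)) =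
        (\<Sum>u\<in>{0<..g}. q powi (1 - int u) * block_coeff a \<alpha>' (\<lambda>\<delta>. S (g - u) \<delta> \<beta>) u)"
      by (rule sum.cong) (auto simp: Cons first_var_def)
    also have "\<dots> = (\<Sum>u\<le>g. q powi (1 - int u) * block_coeff a \<alpha>' (\<lambda>\<delta>. S (g - u) \<delta> \<beta>) u)"
      by (rule sum.mono_neutral_left) (use a in \<open>auto simp: block_coeff_less\<close>)
    finally show ?thesis using Cons a Cons.prems mixed_block \<open>composition \<beta>\<close> by simp
  qed
  have "total_coeff \<alpha> \<beta> (g # gs) =
    (case \<alpha> of [] \<Rightarrow> 0 | a # \<alpha>' \<Rightarrow> open_block_coeff False a \<alpha>' \<beta> (g # gs)) +
    (case \<beta> of [] \<Rightarrow> 0 | b # \<beta>' \<Rightarrow> open_block_coeff True b \<alpha> \<beta>' (g # gs))"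
    by (simp add: total_coeff_first[of \<alpha> \<beta>])
  then show ?case unfolding product only_\<beta> some_\<alpha> by (simp only: add.commute)
qed

theorem product_D_qsym:
  assumes "composition \<alpha>" "composition \<beta>"
  shows "D_qsym q t \<alpha> * D_qsym q t \<beta> =
    (\<Sum>\<gamma>\<in>#two_way_overlapping_shuffles \<alpha> \<beta>.
       qsym_scale ((q + t) ^ c1 \<gamma> * t ^ c2 \<gamma>) (D_qsym q t (plus_composition \<gamma>)))"
proof (rule qsym_eqI)
  fix gs assume gs: "composition gs"
  define n where "n = length \<alpha> + length \<beta>"
  let ?D = "{D. D \<subseteq> {..<n} \<and> card D = length \<beta>}"
  let ?E = "\<lambda>D R. (shuffle_word D \<alpha> \<beta>, shuffle_separators D R n)"
  let ?G = "\<lambda>\<gamma>. qsym_scale ((q + t) ^ c1 \<gamma> * t ^ c2 \<gamma>) (D_qsym q t (plus_composition \<gamma>))"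
  have set: "{(D, R). D \<subseteq> {..<n} \<and> card D = length \<beta> \<and> R \<subseteq> replaceable_commas D n} =
      (SIGMA D:?D. Pow (replaceable_commas D n))" by auto
  have "QM_coeff (\<Sum>\<gamma>\<in>#two_way_overlapping_shuffles \<alpha> \<beta>. ?G \<gamma>) gs =
      QM_coeff (\<Sum>(D, R)\<in>(SIGMA D:?D. Pow (replaceable_commas D n)). ?G (?E D R)) gs"
    unfolding two_way_overlapping_shuffles_def Let_def n_def[symmetric] set
    by (simp add: image_mset.compositionality comp_def case_prod_unfold sum_unfold_sum_mset)
  also have "\<dots> = (\<Sum>D\<in>?D. \<Sum>R\<in>Pow (replaceable_commas D n). QM_coeff (?G (?E D R)) gs)"
    by (subst sum.Sigma) (auto simp: finite_replaceable_commas QM_coeff_sum case_prod_unfold)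
  also have "\<dots> = (\<Sum>D\<in>?D. word_coeff (label D (shuffle_word D \<alpha> \<beta>)) gs)"
  proof (rule sum.cong[OF refl])
    fix D assume "D \<in> ?D"
    then have "composition (shuffle_word D \<alpha> \<beta>)" "length (shuffle_word D \<alpha> \<beta>) = n"
      using composition_shuffle_word[OF assms] by (auto simp: n_def shuffle_word_def)
    then show "(\<Sum>R\<in>Pow (replaceable_commas D n). QM_coeff (?G (?E D R)) gs) =
        word_coeff (label D (shuffle_word D \<alpha> \<beta>)) gs"
      by (simp add: sum_separators[OF gs, symmetric] QM_coeff_scale QM_coeff_D_qsym gs
        plus_composition_def c1_def c2_def composition_add_up separator_weight_def)
  qed
  also have "\<dots> = total_coeff \<alpha> \<beta> gs"
    by (simp add: total_coeff_def shuffle_sum_def n_def)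
  finally show "QM_coeff (D_qsym q t \<alpha> * D_qsym q t \<beta>) gs =
      QM_coeff (\<Sum>\<gamma>\<in>#two_way_overlapping_shuffles \<alpha> \<beta>. ?G \<gamma>) gs"
    by (simp add: QM_coeff_product total_coeff_eq_product_coeff assms gs)
qed

end

lemma q_var_nonzero: "q_var \<noteq> 0"
  by (simp add: q_var_def eq_fract Zero_fract_def)

theorem theorem4p8:
  shows "(\<forall>\<alpha> \<beta>. composition \<alpha> \<longrightarrow> composition \<beta> \<longrightarrow>
            D_qsym q_var t_var \<alpha> * D_qsym q_var t_var \<beta> =
              (\<Sum>\<gamma>\<in>#two_way_overlapping_shuffles \<alpha> \<beta>.
                 qsym_scale ((q_var + t_var) ^ c1 \<gamma> * t_var ^ c2 \<gamma>)
                   (D_qsym q_var t_var (plus_composition \<gamma>))))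
       \<and> (\<forall>\<gamma>. composition \<gamma> \<longrightarrow>
            qsym_coproduct (D_qsym q_var t_var \<gamma>) =
              (\<Sum>(\<alpha>, \<beta>)\<in>{(\<alpha>, \<beta>). \<alpha> @ \<beta> = \<gamma>}.
                 D_qsym q_var t_var \<alpha> \<otimes> D_qsym q_var t_var \<beta>))"
  using product_D_qsym[OF q_var_nonzero] coproduct_D_qsym[OF q_var_nonzero] by blast

end
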